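(* ($\mathsf{ZF}$, without the axiom of choice.) For all infinite cardinals $\mathfrak{a}$ and all non-zero natural numbers $n$, \[ (2^{\mathscr{B}_{n}(\mathfrak{a})})^{\aleph_0}=2^{\mathscr{B}_{n}(\mathfrak{a})}. \]
   Context: Work in $\mathsf{ZF}$ (Zermelo--Fraenkel set theory without the axiom of choice). Cardinals are cardinalities $|A|$ of arbitrary (not necessarily well-orderable) sets; $|A|=|B|$ means there is a bijection between $A$ and $B$; an infinite cardinal is the cardinality of an infinite (i.e. not finite) set. For $\mathfrak{a}=|A|$ and $\mathfrak{b}=|B|$, $\mathfrak{a}^{\mathfrak{b}}$ is the cardinality of the set of all functions from $B$ to $A$; in particular $2^{\mathfrak{a}}=|\mathscr{P}(A)|$. A partition of a set $A$ is a family of pairwise disjoint non-empty subsets of $A$ (called blocks) whose union is $A$; it is finitary if all its blocks are finite. $\mathscr{B}_n(A)$ is the set of all finitary partitions of $A$ with exactly $n$ non-singleton blocks, and $\mathscr{B}_n(\mathfrak{a})=|\mathscr{B}_n(A)|$ where $|A|=\mathfrak{a}$. *)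

theory Defs
  imports Main
begin

text \<open>
  HOL proves the axiom of choice, so the theorem cannot be stated about HOL's own sets: as a theorem
  of ZF it is stated for every first-order model \<open>(M, E)\<close> of ZF, with the universe \<open>M\<close> an arbitrary
  type. By the completeness theorem, truth in all such models is the same as provability in ZF.
  Separation and replacement are required only for first-order formulas with parameters; for
  arbitrary HOL predicates they would force the model to satisfy choice.
\<close>

section \<open>First-order formulas of set theory and models of ZF\<close>

text \<open>Variables are de Bruijn indices: \<open>Forall\<close> binds index 0.\<close>

datatype fm = Mem nat nat | Eq nat nat | Neg fm | Conj fm fm | Forall fm

primrec sat :: "('a \<Rightarrow> 'a \<Rightarrow> bool) \<Rightarrow> (nat \<Rightarrow> 'a) \<Rightarrow> fm \<Rightarrow> bool" where
  "sat E e (Mem i j) = E (e i) (e j)"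
| "sat E e (Eq i j) = (e i = e j)"
| "sat E e (Neg p) = (\<not> sat E e p)"
| "sat E e (Conj p q) = (sat E e p \<and> sat E e q)"
| "sat E e (Forall p) = (\<forall>x. sat E (case_nat x e) p)"

locale ZF_model =
  fixes E :: "'a \<Rightarrow> 'a \<Rightarrow> bool" (infix "\<^bold>\<in>" 50)
  assumes extensionality: "(\<forall>z. z \<^bold>\<in> x \<longleftrightarrow> z \<^bold>\<in> y) \<Longrightarrow> x = y"
    and foundation: "\<exists>y. y \<^bold>\<in> x \<Longrightarrow> \<exists>y. y \<^bold>\<in> x \<and> \<not> (\<exists>z. z \<^bold>\<in> x \<and> z \<^bold>\<in> y)"
    and pairing: "\<exists>p. \<forall>z. z \<^bold>\<in> p \<longleftrightarrow> z = x \<or> z = y"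
    and union: "\<exists>u. \<forall>z. z \<^bold>\<in> u \<longleftrightarrow> (\<exists>y. z \<^bold>\<in> y \<and> y \<^bold>\<in> x)"
    and powerset: "\<exists>p. \<forall>z. z \<^bold>\<in> p \<longleftrightarrow> (\<forall>w. w \<^bold>\<in> z \<longrightarrow> w \<^bold>\<in> x)"
    and infinity: "\<exists>i. (\<exists>v. v \<^bold>\<in> i \<and> (\<forall>z. \<not> z \<^bold>\<in> v)) \<and>
        (\<forall>x. x \<^bold>\<in> i \<longrightarrow> (\<exists>y. y \<^bold>\<in> i \<and> (\<forall>z. z \<^bold>\<in> y \<longleftrightarrow> z \<^bold>\<in> x \<or> z = x)))"
    and separation: "\<exists>s. \<forall>x. x \<^bold>\<in> s \<longleftrightarrow> x \<^bold>\<in> a \<and> sat E (case_nat x e) \<phi>"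
    and replacement:
      "(\<forall>x y y'. x \<^bold>\<in> a \<and> sat E (case_nat x (case_nat y e)) \<phi> \<and>
          sat E (case_nat x (case_nat y' e)) \<phi> \<longrightarrow> y = y') \<Longrightarrow>
       \<exists>r. \<forall>y. y \<^bold>\<in> r \<longleftrightarrow> (\<exists>x. x \<^bold>\<in> a \<and> sat E (case_nat x (case_nat y e)) \<phi>)"


section \<open>Set-theoretic notions inside a model\<close>

text \<open>
  All notions below are internal: every quantifier ranges over elements of the model. In particular
  functions, bijections and natural numbers are those of the model, and a natural number of the
  model need not be standard.
\<close>

context
  fixes E :: "'a \<Rightarrow> 'a \<Rightarrow> bool" (infix "\<^bold>\<in>" 50)
begin

text \<open>
  The set with the given extension; meaningful only if the model has such a set. For each use below
  in a model of ZF this is proved in the last section (lemmas \<open>mem_...\<close>).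
\<close>

definition set_of :: "('a \<Rightarrow> bool) \<Rightarrow> 'a" where
  "set_of P = (THE s. \<forall>x. x \<^bold>\<in> s \<longleftrightarrow> P x)"

definition empty_set :: 'a where
  "empty_set = set_of (\<lambda>x. False)"

definition upair :: "'a \<Rightarrow> 'a \<Rightarrow> 'a" where
  "upair x y = set_of (\<lambda>z. z = x \<or> z = y)"

definition opair :: "'a \<Rightarrow> 'a \<Rightarrow> 'a" where
  "opair x y = upair (upair x x) (upair x y)"

definition succ :: "'a \<Rightarrow> 'a" where
  "succ x = set_of (\<lambda>z. z \<^bold>\<in> x \<or> z = x)"

definition is_inductive :: "'a \<Rightarrow> bool" where
  "is_inductive i \<longleftrightarrow> empty_set \<^bold>\<in> i \<and> (\<forall>x. x \<^bold>\<in> i \<longrightarrow> succ x \<^bold>\<in> i)"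

definition omega :: 'a where
  "omega = set_of (\<lambda>n. \<forall>i. is_inductive i \<longrightarrow> n \<^bold>\<in> i)"

definition two :: 'a where
  "two = succ (succ empty_set)"

definition is_function :: "'a \<Rightarrow> 'a \<Rightarrow> 'a \<Rightarrow> bool" where
  "is_function f A B \<longleftrightarrow>
     (\<forall>p. p \<^bold>\<in> f \<longrightarrow> (\<exists>x y. x \<^bold>\<in> A \<and> y \<^bold>\<in> B \<and> p = opair x y)) \<and>
     (\<forall>x. x \<^bold>\<in> A \<longrightarrow> (\<exists>!y. opair x y \<^bold>\<in> f))"

definition is_bijection :: "'a \<Rightarrow> 'a \<Rightarrow> 'a \<Rightarrow> bool" where
  "is_bijection f A B \<longleftrightarrow> is_function f A B \<and> (\<forall>y. y \<^bold>\<in> B \<longrightarrow> (\<exists>!x. opair x y \<^bold>\<in> f))"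

definition equipotent :: "'a \<Rightarrow> 'a \<Rightarrow> bool" where
  "equipotent A B \<longleftrightarrow> (\<exists>f. is_bijection f A B)"

definition finite_set :: "'a \<Rightarrow> bool" where
  "finite_set A \<longleftrightarrow> (\<exists>n. n \<^bold>\<in> omega \<and> equipotent A n)"

text \<open>\<open>card_exp A B\<close> represents the cardinal power \<open>|A|\<close> to the \<open>|B|\<close>: the functions from \<open>B\<close> to \<open>A\<close>.\<close>

definition card_exp :: "'a \<Rightarrow> 'a \<Rightarrow> 'a" where
  "card_exp A B = set_of (\<lambda>f. is_function f B A)"

definition is_partition :: "'a \<Rightarrow> 'a \<Rightarrow> bool" where
  "is_partition P A \<longleftrightarrow>
     (\<forall>b. b \<^bold>\<in> P \<longrightarrow> (\<exists>x. x \<^bold>\<in> b) \<and> (\<forall>x. x \<^bold>\<in> b \<longrightarrow> x \<^bold>\<in> A)) \<and>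
     (\<forall>b c. b \<^bold>\<in> P \<longrightarrow> c \<^bold>\<in> P \<longrightarrow> b \<noteq> c \<longrightarrow> \<not> (\<exists>x. x \<^bold>\<in> b \<and> x \<^bold>\<in> c)) \<and>
     (\<forall>x. x \<^bold>\<in> A \<longrightarrow> (\<exists>b. b \<^bold>\<in> P \<and> x \<^bold>\<in> b))"

definition finitary_partition :: "'a \<Rightarrow> 'a \<Rightarrow> bool" where
  "finitary_partition P A \<longleftrightarrow> is_partition P A \<and> (\<forall>b. b \<^bold>\<in> P \<longrightarrow> finite_set b)"

definition nonsingleton_blocks :: "'a \<Rightarrow> 'a" where
  "nonsingleton_blocks P = set_of (\<lambda>b. b \<^bold>\<in> P \<and> \<not> (\<exists>x. b = upair x x))"

definition Bn :: "'a \<Rightarrow> 'a \<Rightarrow> 'a" where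
  "Bn n A = set_of (\<lambda>P. finitary_partition P A \<and> equipotent (nonsingleton_blocks P) n)"

end


section \<open>The sets denoted by \<open>set_of\<close> exist in every model\<close>

context ZF_model
begin

abbreviation extension :: "('a \<Rightarrow> bool) \<Rightarrow> 'a \<Rightarrow> bool" where
  "extension P s \<equiv> (\<forall>x. x \<^bold>\<in> s \<longleftrightarrow> P x)"

lemma ext_iff: "x = y \<longleftrightarrow> (\<forall>z. z \<^bold>\<in> x \<longleftrightarrow> z \<^bold>\<in> y)"
  using extensionality by blast

lemma mem_set_of:
  assumes "\<exists>s. extension P s"
  shows "x \<^bold>\<in> set_of E P \<longleftrightarrow> P x"
proof -
  obtain s where s: "extension P s" using assms by blast
  then have "set_of E P = s"
    unfolding set_of_def by (intro the_equality) (simp_all add: ext_iff)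
  with s show ?thesis by simp
qed

text \<open>Predicates of an assignment that are given by a formula.\<close>

definition definable :: "((nat \<Rightarrow> 'a) \<Rightarrow> bool) \<Rightarrow> bool" where
  "definable P \<longleftrightarrow> (\<exists>\<phi>. \<forall>e. P e = sat E e \<phi>)"

lemma definable_mem: "definable (\<lambda>e. e i \<^bold>\<in> e j)"
  unfolding definable_def by (rule exI[of _ "Mem i j"]) simp

lemma definable_eq: "definable (\<lambda>e. e i = e j)"
  unfolding definable_def by (rule exI[of _ "Eq i j"]) simp

lemma definable_not: "definable P \<Longrightarrow> definable (\<lambda>e. \<not> P e)"
  unfolding definable_def by (metis sat.simps(3))

lemma definable_conj: "definable P \<Longrightarrow> definable Q \<Longrightarrow> definable (\<lambda>e. P e \<and> Q e)"
  unfolding definable_def by (metis sat.simps(4))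

lemma definable_disj:
  assumes "definable P" "definable Q"
  shows "definable (\<lambda>e. P e \<or> Q e)"
proof -
  have "definable (\<lambda>e. \<not> (\<not> P e \<and> \<not> Q e))"
    using assms by (intro definable_not definable_conj)
  then show ?thesis by simp
qed

lemma definable_imp: "definable P \<Longrightarrow> definable Q \<Longrightarrow> definable (\<lambda>e. P e \<longrightarrow> Q e)"
  unfolding imp_conv_disj by (intro definable_disj definable_not)

lemma definable_iff: "definable P \<Longrightarrow> definable Q \<Longrightarrow> definable (\<lambda>e. P e \<longleftrightarrow> Q e)"
  unfolding iff_conv_conj_imp by (intro definable_conj definable_imp)

lemma definable_all:
  assumes "definable (\<lambda>e. P (e 0) (\<lambda>n. e (Suc n)))"
  shows "definable (\<lambda>e. \<forall>x. P x e)"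
proof -
  obtain \<phi> where \<phi>: "\<And>e. P (e 0) (\<lambda>n. e (Suc n)) = sat E e \<phi>"
    using assms unfolding definable_def by blast
  have "(\<forall>x. P x e) = sat E e (Forall \<phi>)" for e
    using \<phi>[of "case_nat x e" for x] by simp
  then show ?thesis unfolding definable_def by blast
qed

lemma definable_ex:
  assumes "definable (\<lambda>e. P (e 0) (\<lambda>n. e (Suc n)))"
  shows "definable (\<lambda>e. \<exists>x. P x e)"
proof -
  have "definable (\<lambda>e. \<forall>x. \<not> P x e)"
    by (rule definable_all) (rule definable_not[OF assms])
  from definable_not[OF this] show ?thesis by simp
qed

lemmas definable_intros = definable_mem definable_eq definable_conj definable_disj
  definable_imp definable_iff 
  definable_all definable_ex definable_not

lemma separation_definable:
  assumes "definable P"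
  shows "\<exists>s. extension (\<lambda>x. x \<^bold>\<in> a \<and> P (case_nat x e)) s"
  using assms separation[of a e] unfolding definable_def by auto

lemma separation_bounded:
  assumes "definable P" and "\<And>x. P (case_nat x e) \<longleftrightarrow> Q x" and "\<And>x. Q x \<Longrightarrow> x \<^bold>\<in> a"
  shows "\<exists>s. extension Q s"
proof -
  obtain s where "extension (\<lambda>x. x \<^bold>\<in> a \<and> P (case_nat x e)) s"
    using separation_definable[OF assms(1), of a e] by blast
  then have "extension Q s" using assms(2,3) by blast
  then show ?thesis ..
qed

lemma mem_empty: "x \<^bold>\<in> empty_set E \<longleftrightarrow> False"
  unfolding empty_set_def
proof (rule mem_set_of, rule separation_bounded)
  show "definable (\<lambda>e. \<not> e 0 = e 0)" by (intro definable_intros)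
qed simp_all

lemma mem_upair: "z \<^bold>\<in> upair E x y \<longleftrightarrow> z = x \<or> z = y"
  unfolding upair_def by (rule mem_set_of) (rule pairing)

lemma ex_un: "\<exists>s. extension (\<lambda>z. z \<^bold>\<in> a \<or> z \<^bold>\<in> b) s"
  using union[of "upair E a b"] by (auto simp: mem_upair)

lemma mem_succ: "z \<^bold>\<in> succ E x \<longleftrightarrow> z \<^bold>\<in> x \<or> z = x"
  unfolding succ_def
  by (rule mem_set_of) (use ex_un[of x "upair E x x"] in \<open>simp add: mem_upair\<close>)

lemma eq_upair_iff: "p = upair E x y \<longleftrightarrow> (\<forall>z. z \<^bold>\<in> p \<longleftrightarrow> z = x \<or> z = y)"
  by (subst ext_iff) (simp only: mem_upair)

lemma definable_upair: "definable (\<lambda>e. e p = upair E (e i) (e j))"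
  unfolding eq_upair_iff by (intro definable_intros)

lemma eq_opair_iff: "p = opair E x y \<longleftrightarrow> (\<exists>a b. a = upair E x x \<and> b = upair E x y \<and> p = upair E a b)"
  by (simp add: opair_def)

lemma definable_opair: "definable (\<lambda>e. e p = opair E (e i) (e j))"
  unfolding eq_opair_iff by (intro definable_intros definable_upair)

lemma opair_mem_iff: "opair E x y \<^bold>\<in> f \<longleftrightarrow> (\<exists>p. p = opair E x y \<and> p \<^bold>\<in> f)"
  by simp

lemma definable_opair_mem: "definable (\<lambda>e. opair E (e i) (e j) \<^bold>\<in> e f)"
  unfolding opair_mem_iff by (intro definable_intros definable_opair)

lemma definable_fun: "definable (\<lambda>e. is_function E (e f) (e A) (e B))"
  unfolding is_function_def Ex1_def by (intro definable_intros definable_opair definable_opair_mem)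

lemma definable_bij: "definable (\<lambda>e. is_bijection E (e f) (e A) (e B))"
  unfolding is_bijection_def Ex1_def by (intro definable_intros definable_fun definable_opair_mem)

lemma definable_eqp: "definable (\<lambda>e. equipotent E (e A) (e B))"
  unfolding equipotent_def by (intro definable_intros definable_bij)

lemma eq_succ_iff: "p = succ E x \<longleftrightarrow> (\<forall>z. z \<^bold>\<in> p \<longleftrightarrow> z \<^bold>\<in> x \<or> z = x)"
  by (subst ext_iff) (simp only: mem_succ)

lemma definable_succ: "definable (\<lambda>e. e p = succ E (e i))"
  unfolding eq_succ_iff by (intro definable_intros)

lemma eq_empty_iff: "p = empty_set E \<longleftrightarrow> (\<forall>z. \<not> z \<^bold>\<in> p)"
  by (subst ext_iff) (simp add: mem_empty)

lemma is_inductive_iff: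
  "is_inductive E i \<longleftrightarrow> (\<exists>p. (\<forall>z. \<not> z \<^bold>\<in> p) \<and> p \<^bold>\<in> i) \<and>
     (\<forall>x. x \<^bold>\<in> i \<longrightarrow> (\<exists>y. y = succ E x \<and> y \<^bold>\<in> i))"
  unfolding is_inductive_def eq_empty_iff[symmetric] by simp

lemma definable_is_inductive: "definable (\<lambda>e. is_inductive E (e i))"
  unfolding is_inductive_iff by (intro definable_intros definable_succ)

lemma ex_inductive: "\<exists>i. is_inductive E i"
proof -
  from infinity obtain i where i: "(\<exists>v. v \<^bold>\<in> i \<and> (\<forall>z. \<not> z \<^bold>\<in> v)) \<and>
      (\<forall>x. x \<^bold>\<in> i \<longrightarrow> (\<exists>y. y \<^bold>\<in> i \<and> (\<forall>z. z \<^bold>\<in> y \<longleftrightarrow> z \<^bold>\<in> x \<or> z = x)))" ..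
  note zero = conjunct1[OF i] and step = conjunct2[OF i]
  from zero have "empty_set E \<^bold>\<in> i" unfolding eq_empty_iff[symmetric] by simp
  moreover from step have "\<forall>x. x \<^bold>\<in> i \<longrightarrow> succ E x \<^bold>\<in> i" unfolding eq_succ_iff[symmetric] by simp
  ultimately have "is_inductive E i" by (simp add: is_inductive_def)
  then show ?thesis ..
qed

lemma mem_omega: "n \<^bold>\<in> omega E \<longleftrightarrow> (\<forall>i. is_inductive E i \<longrightarrow> n \<^bold>\<in> i)"
proof -
  obtain i where i: "is_inductive E i" using ex_inductive by blast
  show ?thesis
    unfolding omega_def
  proof (rule mem_set_of, rule separation_bounded[where a = i])
    show "definable (\<lambda>e. \<forall>i. is_inductive E i \<longrightarrow> e 0 \<^bold>\<in> i)"
      by (intro definable_intros definable_is_inductive)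
  qed (use i in simp_all)
qed

lemma power_bound: "\<exists>p. \<forall>z. (\<forall>w. w \<^bold>\<in> z \<longrightarrow> w \<^bold>\<in> x) \<longrightarrow> z \<^bold>\<in> p"
proof -
  from powerset[of x] obtain p where "\<forall>z. z \<^bold>\<in> p \<longleftrightarrow> (\<forall>w. w \<^bold>\<in> z \<longrightarrow> w \<^bold>\<in> x)" ..
  then have "\<forall>z. (\<forall>w. w \<^bold>\<in> z \<longrightarrow> w \<^bold>\<in> x) \<longrightarrow> z \<^bold>\<in> p" by simp
  then show ?thesis ..
qed

lemma mem_card_exp: "f \<^bold>\<in> card_exp E A B \<longleftrightarrow> is_function E f B A"
proof -
  obtain u where u: "\<forall>z. z \<^bold>\<in> u \<longleftrightarrow> z \<^bold>\<in> A \<or> z \<^bold>\<in> B"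
    using ex_un[of A B] ..
  obtain p where p: "\<forall>z. (\<forall>w. w \<^bold>\<in> z \<longrightarrow> w \<^bold>\<in> u) \<longrightarrow> z \<^bold>\<in> p"
    using power_bound[of u] ..
  obtain q where q: "\<forall>z. (\<forall>w. w \<^bold>\<in> z \<longrightarrow> w \<^bold>\<in> p) \<longrightarrow> z \<^bold>\<in> q"
    using power_bound[of p] ..
  obtain r where r: "\<forall>z. (\<forall>w. w \<^bold>\<in> z \<longrightarrow> w \<^bold>\<in> q) \<longrightarrow> z \<^bold>\<in> r"
    using power_bound[of q] ..
  have pair: "opair E x y \<^bold>\<in> q" if "x \<^bold>\<in> u" "y \<^bold>\<in> u" for x y
    unfolding opair_def by (rule q[rule_format]) (use that in \<open>auto simp: mem_upair intro!: p[rule_format]\<close>)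
  have bound: "f \<^bold>\<in> r" if "is_function E f B A" for f
  proof (rule r[rule_format])
    fix w assume "w \<^bold>\<in> f"
    then obtain x y where "x \<^bold>\<in> B" "y \<^bold>\<in> A" "w = opair E x y"
      using \<open>is_function E f B A\<close> unfolding is_function_def by blast
    then show "w \<^bold>\<in> q" using u pair by simp
  qed
  show ?thesis
    unfolding card_exp_def
  proof (rule mem_set_of,
      rule separation_bounded[where a = r and e = "case_nat B (case_nat A undefined)"])
    show "definable (\<lambda>e. is_function E (e 0) (e (Suc 0)) (e (Suc (Suc 0))))"
      by (rule definable_fun)
  qed (simp_all add: bound)
qed

lemma mem_nonsingleton_blocks:
  "b \<^bold>\<in> nonsingleton_blocks E P \<longleftrightarrow> b \<^bold>\<in> P \<and> \<not> (\<exists>x. b = upair E x x)"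
proof -
  have "definable (\<lambda>e. \<not> (\<exists>x. e 0 = upair E x x))"
    by (intro definable_intros definable_upair)
  from separation_definable[OF this, of P undefined] show ?thesis
    unfolding nonsingleton_blocks_def by (intro mem_set_of) simp
qed

lemma equipotent_nonsingleton_iff:
  "equipotent E (nonsingleton_blocks E P) n \<longleftrightarrow>
     (\<exists>N. (\<forall>b. b \<^bold>\<in> N \<longleftrightarrow> b \<^bold>\<in> P \<and> \<not> (\<exists>x. b = upair E x x)) \<and> equipotent E N n)"
proof -
  have "(\<forall>b. b \<^bold>\<in> N \<longleftrightarrow> b \<^bold>\<in> P \<and> \<not> (\<exists>x. b = upair E x x)) \<longleftrightarrow> N = nonsingleton_blocks E P" for N
    unfolding mem_nonsingleton_blocks[symmetric] by (rule ext_iff[symmetric])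
  then show ?thesis by simp
qed

lemma mem_Bn:
  "P \<^bold>\<in> Bn E n A \<longleftrightarrow> finitary_partition E P A \<and> equipotent E (nonsingleton_blocks E P) n"
proof -
  obtain p where p: "\<forall>z. (\<forall>w. w \<^bold>\<in> z \<longrightarrow> w \<^bold>\<in> A) \<longrightarrow> z \<^bold>\<in> p"
    using power_bound[of A] ..
  obtain q where q: "\<forall>z. (\<forall>w. w \<^bold>\<in> z \<longrightarrow> w \<^bold>\<in> p) \<longrightarrow> z \<^bold>\<in> q"
    using power_bound[of p] ..
  have bound: "P \<^bold>\<in> q" if "is_partition E P A" for P
  proof (rule q[rule_format], rule p[rule_format])
    fix b w assume "b \<^bold>\<in> P" "w \<^bold>\<in> b"
    with that show "w \<^bold>\<in> A" unfolding is_partition_def by blast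
  qed
  let ?e = "case_nat A (case_nat (omega E) (case_nat n undefined))"
  show ?thesis
    unfolding Bn_def
  proof (rule mem_set_of, rule separation_bounded[where a = q and e = ?e])
    show "definable (\<lambda>e. (is_partition E (e 0) (e (Suc 0)) \<and>
        (\<forall>b. b \<^bold>\<in> e 0 \<longrightarrow> (\<exists>m. m \<^bold>\<in> e (Suc (Suc 0)) \<and> equipotent E b m))) \<and>
        equipotent E (nonsingleton_blocks E (e 0)) (e (Suc (Suc (Suc 0)))))"
      unfolding is_partition_def equipotent_nonsingleton_iff
      by (intro definable_intros definable_upair definable_eqp)
  qed (simp_all add: finitary_partition_def finite_set_def bound)
qed

end

end

theory Submission
  imports Defs
begin

text \<open>
  Write \<open>B\<close> for the set \<open>Bn n A\<close> of finitary partitions of the infinite set \<open>A\<close> with exactly \<open>n\<close>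
  non-singleton blocks. The constant sequences inject \<open>2^B\<close> into \<open>(2^B)^\<omega>\<close>. By the Cantor-Bernstein
  theorem, which does not need choice, it remains to code a sequence \<open>h\<close> of subsets of \<open>B\<close> by a single
  subset of \<open>B\<close>.

  The code uses parities. The support of a partition is the finite union of its non-singleton blocks.
  Its size determines a pair \<open>(b, i)\<close> of natural numbers, by dividing \<open>\<omega>\<close> into consecutive intervals,
  one for each pair \<open>i < b\<close>, that grow very fast (\<open>sized\<close>, \<open>sized_unique\<close>). The code
  of \<open>h\<close> contains a partition \<open>y\<close> of class \<open>(b, i)\<close> iff the number of members of \<open>h(i)\<close> that refine \<open>y\<close> and
  have at most \<open>b\<close> points in their support is odd. That number is finite, since \<open>y\<close> has only finitely many
  refinements in \<open>B\<close> (\<open>finite_refinements\<close>).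

  To see that the code determines \<open>h\<close>, let \<open>D\<close> be the symmetric difference of the \<open>i\<close>-th terms of two
  sequences with the same code. For every \<open>y\<close> of a class \<open>(b, i)\<close>, an even number of members of \<open>D\<close> of
  support size at most \<open>b\<close> refine \<open>y\<close>. Suppose that \<open>D\<close> is not empty. It has a member \<open>P\<close> of which it contains no
  other refinement. Choose \<open>b\<close> larger than \<open>i\<close> and than the support of \<open>P\<close>, and \<open>b + 1\<close> disjoint finite sets
  \<open>Z_0, ..., Z_b\<close> outside the support of \<open>P\<close>, all of which have the least size of class \<open>(b, i)\<close>. For a set
  \<open>W\<close> of indices, let \<open>y_W\<close> be \<open>P\<close> with one fixed non-singleton block enlarged by the \<open>Z_l\<close> with \<open>l\<close> in \<open>W\<close>;
  such a block exists as \<open>n\<close> is not zero. The intervals are long enough that \<open>y_W\<close> has class \<open>(b, i)\<close> unless \<open>W\<close> is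
  empty (\<open>next_size_not_covered\<close>). Let \<open>e(W)\<close> be the parity of the number of members of \<open>D\<close> of support size at most
  \<open>b\<close> that refine \<open>y_W\<close>. So \<open>e(W)\<close> is even for all non-empty \<open>W\<close>, while \<open>e\<close> of the empty set is odd,
  because only \<open>P\<close> itself is counted. Hence the alternating sum of all \<open>e(W)\<close>, which modulo 2 is
  just their sum, is odd. By inclusion and exclusion it counts the members of \<open>D\<close> of support size at most \<open>b\<close>
  that refine the largest partition \<open>y_W\<close> and whose support meets each of the \<open>b + 1\<close> sets \<open>Z_l\<close>.
  There are none, a contradiction (\<open>parities_determine\<close>).

  The model may have non-standard natural numbers, so \<open>n\<close>, \<open>b\<close> and the finite sets above can be infinite when seen from outside.
  All counting therefore takes place inside the model, where sums are not available until they are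
  constructed. Sizes are compared by surjections, parity is characterized by how it changes when one
  element is added (\<open>odd_set\<close>), and inclusion and exclusion becomes an induction over internally
  finite sets of indices.
\<close>


section \<open>Definability with parameters\<close>

primrec rename :: "(nat \<Rightarrow> nat) \<Rightarrow> fm \<Rightarrow> fm" where
  "rename r (Mem i j) = Mem (r i) (r j)"
| "rename r (Eq i j) = Eq (r i) (r j)"
| "rename r (Neg p) = Neg (rename r p)"
| "rename r (Conj p q) = Conj (rename r p) (rename r q)"
| "rename r (Forall p) = Forall (rename (case_nat 0 (\<lambda>n. Suc (r n))) p)"

lemma sat_rename: "sat E e (rename r p) = sat E (\<lambda>n. e (r n)) p"
proof (induction p arbitrary: e r)
  case (Forall p)
  have "(\<lambda>n. case_nat x e (case_nat 0 (\<lambda>n. Suc (r n)) n)) = case_nat x (\<lambda>n. e (r n))" for x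
    by (rule ext) (simp split: nat.split)
  then show ?case using Forall by simp
qed simp_all

text \<open>
  An assignment with an infinite supply of variables at the even places and of parameters at the odd
  places. Infinitely many parameters allow two formulas to be combined without clashes by renaming.
\<close>

definition interleave :: "(nat \<Rightarrow> 'a) \<Rightarrow> (nat \<Rightarrow> 'a) \<Rightarrow> nat \<Rightarrow> 'a" where
  "interleave e f n = (if even n then e (n div 2) else f (n div 2))"

lemma interleave_simps [simp]:
  "interleave e f (2 * n) = e n" "interleave e f (Suc (2 * n)) = f n"
  by (simp_all add: interleave_def)

lemma interleave_eqI:
  assumes "\<And>n. g (2 * n) = e n" "\<And>n. g (Suc (2 * n)) = f n"
  shows "g = interleave e f"
proof
  fix n show "g n = interleave e f n"
    by (cases "even n") (auto elim!: evenE oddE simp: assms interleave_def)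
qed

text \<open>
  As a renaming, \<open>place r s\<close> puts variables and parameters at the places given by \<open>r\<close> and \<open>s\<close>
  respectively.
\<close>

definition place :: "(nat \<Rightarrow> nat) \<Rightarrow> (nat \<Rightarrow> nat) \<Rightarrow> nat \<Rightarrow> nat" where
  "place = interleave"

lemma sat_rename_place:
  "sat E h (rename (place r s) p) = sat E (interleave (\<lambda>n. h (r n)) (\<lambda>n. h (s n))) p"
  unfolding sat_rename place_def by (rule arg_cong[where f = "\<lambda>g. sat E g p"], rule interleave_eqI) simp_all

named_theorems definability

context ZF_model
begin

text \<open>
  Separation and replacement are available for predicates that are definable with parameters from the
  model. The parameters are chosen existentially here, so that in a goal \<open>defpred (\<lambda>e. \<dots>)\<close> every HOL
  variable of the type of the universe is a parameter. The rules \<open>definability\<close> follow the syntax of the predicate: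
  quantifiers shift the assignment by one, and for every set-theoretic operation there is a rule for
  \<open>defterm\<close>. Thus \<open>intro definability\<close> proves the definability of the predicates written down
  below.
\<close>

definition defpred :: "((nat \<Rightarrow> 'a) \<Rightarrow> bool) \<Rightarrow> bool" where
  "defpred P \<longleftrightarrow> (\<exists>p ps. \<forall>e. P e \<longleftrightarrow> sat E (interleave e ps) p)"

definition defterm :: "((nat \<Rightarrow> 'a) \<Rightarrow> 'a) \<Rightarrow> bool" where
  "defterm t \<longleftrightarrow> defpred (\<lambda>e. e 0 = t (\<lambda>n. e (Suc n)))"

lemma defpredE:
  assumes "defpred P"
  obtains p ps where "\<And>e. P e \<longleftrightarrow> sat E (interleave e ps) p"
  using assms unfolding defpred_def by blast

lemma defpredI: "(\<And>e. P e \<longleftrightarrow> sat E (interleave e ps) p) \<Longrightarrow> defpred P"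
  unfolding defpred_def by blast

lemma defpred_not [definability]: "defpred P \<Longrightarrow> defpred (\<lambda>e. \<not> P e)"
  by (erule defpredE, rule defpredI[where p = "Neg p" for p]) simp

lemma defpred_conj [definability]:
  assumes "defpred P" "defpred Q"
  shows "defpred (\<lambda>e. P e \<and> Q e)"
proof -
  obtain p ps where p: "\<And>e. P e \<longleftrightarrow> sat E (interleave e ps) p" using assms(1) by (rule defpredE) blast
  obtain q qs where q: "\<And>e. Q e \<longleftrightarrow> sat E (interleave e qs) q" using assms(2) by (rule defpredE) blast
  show ?thesis
    by (rule defpredI[where ps = "interleave ps qs" and
      p = "Conj (rename (place (\<lambda>n. 2 * n) (\<lambda>n. Suc (2 * (2 * n)))) p)
                (rename (place (\<lambda>n. 2 * n) (\<lambda>n. Suc (2 * Suc (2 * n)))) q)"])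
      (simp only: sat.simps sat_rename_place interleave_simps p q)
qed

lemma defpred_all [definability]:
  assumes "defpred (\<lambda>e. P (e 0) (\<lambda>n. e (Suc n)))"
  shows "defpred (\<lambda>e. \<forall>x. P x e)"
proof -
  obtain p ps where p: "\<And>e. P (e 0) (\<lambda>n. e (Suc n)) \<longleftrightarrow> sat E (interleave e ps) p"
    using assms by (rule defpredE) blast
  have *: "P x e \<longleftrightarrow> sat E (interleave (case_nat x e) ps) p" for x e
    using p[of "case_nat x e"] by simp
  have **: "(\<lambda>n. case_nat x (interleave e ps) (case_nat 0 (\<lambda>n. Suc (2 * n)) n)) = case_nat x e" for x e
    by (rule ext) (simp split: nat.split)
  show ?thesis
    by (rule defpredI[where ps = ps and
      p = "Forall (rename (place (case_nat 0 (\<lambda>n. Suc (2 * n))) (\<lambda>n. Suc (Suc (2 * n)))) p)"])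
      (simp add: sat_rename_place * ** )
qed

lemma defpred_rename:
  assumes "defpred P"
  shows "defpred (\<lambda>e. P (\<lambda>n. e (r n)))"
proof -
  obtain p ps where p: "\<And>e. P e \<longleftrightarrow> sat E (interleave e ps) p" using assms(1) by (rule defpredE) blast
  show ?thesis
    by (rule defpredI[where ps = ps and p = "rename (place (\<lambda>n. 2 * r n) (\<lambda>n. Suc (2 * n))) p"])
      (simp add: sat_rename_place p)
qed

text \<open>
  This turns the outer variables of a set-builder term into parameters, so that separation and
  replacement apply to it for each value of these variables.
\<close>

lemma defpred_fix:
  assumes "defpred P"
  shows "defpred (\<lambda>e. P (\<lambda>n. if n < k then e n else c n))"
proof -
  obtain p ps where p: "\<And>e. P e \<longleftrightarrow> sat E (interleave e ps) p" using assms(1) by (rule defpredE) blast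
  have *: "(\<lambda>n. interleave e (interleave c ps) (if n < k then 2 * n else Suc (2 * (2 * n))))
     = (\<lambda>n. if n < k then e n else c n)" for e
    by (rule ext) (simp only: interleave_simps if_distrib[of "interleave e (interleave c ps)"])
  show ?thesis
    by (rule defpredI[where ps = "interleave c ps" and
       p = "rename (place (\<lambda>n. if n < k then 2 * n else Suc (2 * (2 * n))) (\<lambda>n. Suc (2 * Suc (2 * n)))) p"])
      (simp only: sat_rename_place p * interleave_simps)
qed

lemma defpred_disj [definability]: "defpred P \<Longrightarrow> defpred Q \<Longrightarrow> defpred (\<lambda>e. P e \<or> Q e)"
  using defpred_not[OF defpred_conj[OF defpred_not defpred_not, of P Q]] by simp

lemma defpred_imp [definability]: "defpred P \<Longrightarrow> defpred Q \<Longrightarrow> defpred (\<lambda>e. P e \<longrightarrow> Q e)"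
  unfolding imp_conv_disj by (intro defpred_disj defpred_not)

lemma defpred_iff [definability]: "defpred P \<Longrightarrow> defpred Q \<Longrightarrow> defpred (\<lambda>e. P e \<longleftrightarrow> Q e)"
  unfolding iff_conv_conj_imp by (intro defpred_conj defpred_imp)

lemma defpred_ex [definability]:
  assumes "defpred (\<lambda>e. P (e 0) (\<lambda>n. e (Suc n)))"
  shows "defpred (\<lambda>e. \<exists>x. P x e)"
  using defpred_not[OF defpred_all[of "\<lambda>x e. \<not> P x e", OF defpred_not[OF assms]]] by simp

lemma defpred_const [definability]: "defpred (\<lambda>e. b)"
proof (cases b)
  case True then show ?thesis by (intro defpredI[where p = "Eq 0 0"]) simp
next
  case False then show ?thesis by (intro defpredI[where p = "Neg (Eq 0 0)"]) simp
qed

lemma defterm_var [definability]: "defterm (\<lambda>e. e i)"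
  unfolding defterm_def
  by (rule defpredI[where p = "Eq (2 * 0) (2 * Suc i)"]) (simp only: sat.simps interleave_simps)

lemma defterm_const [definability]: "defterm (\<lambda>e. c)"
  unfolding defterm_def
  by (rule defpredI[where p = "Eq (2 * 0) (Suc (2 * 0))" and ps = "\<lambda>_. c"])
    (simp only: sat.simps interleave_simps)

lemma defpred_subst:
  assumes "defpred (\<lambda>e. P (e 0) (\<lambda>n. e (Suc n)))" "defterm t"
  shows "defpred (\<lambda>e. P (t e) e)"
proof -
  have "defpred (\<lambda>e. \<exists>x. x = t e \<and> P x e)"
    using assms unfolding defterm_def by (intro defpred_ex defpred_conj)
  then show ?thesis by simp
qed

lemma defterm_rename: "defterm t \<Longrightarrow> defterm (\<lambda>e. t (\<lambda>n. e (r n)))"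
  unfolding defterm_def
  by (drule defpred_rename[where r = "case_nat 0 (\<lambda>n. Suc (r n))"]) simp

lemma defterm_shift: "defterm t \<Longrightarrow> defterm (\<lambda>e. t (\<lambda>n. e (Suc n)))"
  by (rule defterm_rename)

lemma defpred_subst1: "defpred (\<lambda>e. P (e 0)) \<Longrightarrow> defterm t \<Longrightarrow> defpred (\<lambda>e. P (t e))"
  by (rule defpred_subst)

lemma defpred_subst2:
  assumes "defpred (\<lambda>e. R (e 0) (e (Suc 0)))" "defterm t" "defterm u"
  shows "defpred (\<lambda>e. R (t e) (u e))"
proof (rule defpred_subst[where P = "\<lambda>x e. R x (u e)", OF _ assms(2)])
  have "defpred (\<lambda>e. R (e (Suc 0)) (e 0))"
    using defpred_rename[OF assms(1), of "case_nat (Suc 0) (case_nat 0 undefined)"] by simp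
  then show "defpred (\<lambda>e. R (e 0) (u (\<lambda>n. e (Suc n))))"
    by (rule defpred_subst[where P = "\<lambda>x e. R (e 0) x", OF _ defterm_shift[OF assms(3)]])
qed

lemma defpred_subst3:
  assumes "defpred (\<lambda>e. R (e 0) (e (Suc 0)) (e (Suc (Suc 0))))" "defterm t" "defterm u" "defterm v"
  shows "defpred (\<lambda>e. R (t e) (u e) (v e))"
proof (rule defpred_subst[where P = "\<lambda>x e. R x (u e) (v e)", OF _ assms(2)])
  show "defpred (\<lambda>e. R (e 0) (u (\<lambda>n. e (Suc n))) (v (\<lambda>n. e (Suc n))))"
  proof (rule defpred_subst[where P = "\<lambda>x e. R (e 0) x (v (\<lambda>n. e (Suc n)))", OF _ defterm_shift[OF assms(3)]])
    show "defpred (\<lambda>e. R (e (Suc 0)) (e 0) (v (\<lambda>n. e (Suc (Suc n)))))"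
    proof (rule defpred_subst[where P = "\<lambda>x e. R (e (Suc 0)) (e 0) x",
          OF _ defterm_shift[OF defterm_shift[OF assms(4)]]])
      show "defpred (\<lambda>e. R (e (Suc (Suc 0))) (e (Suc 0)) (e 0))"
        using defpred_rename[OF assms(1),
            of "case_nat (Suc (Suc 0)) (case_nat (Suc 0) (case_nat 0 undefined))"] by simp
    qed
  qed
qed

lemma defpred_mem [definability]: "defterm t \<Longrightarrow> defterm u \<Longrightarrow> defpred (\<lambda>e. t e \<^bold>\<in> u e)"
  by (rule defpred_subst2, rule defpredI[where p = "Mem (2 * 0) (2 * Suc 0)"])
    (simp only: sat.simps interleave_simps)

lemma defpred_eq [definability]: "defterm t \<Longrightarrow> defterm u \<Longrightarrow> defpred (\<lambda>e. t e = u e)"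
  by (rule defpred_subst2, rule defpredI[where p = "Eq (2 * 0) (2 * Suc 0)"])
    (simp only: sat.simps interleave_simps)

lemma defterm_subst:
  assumes "defterm (\<lambda>e. f (e 0) (\<lambda>n. e (Suc n)))" "defterm t"
  shows "defterm (\<lambda>e. f (t e) e)"
proof -
  have "defpred (\<lambda>e. e (Suc 0) = f (e 0) (\<lambda>n. e (Suc (Suc n))))"
    using defpred_rename[OF assms(1)[unfolded defterm_def], of "case_nat (Suc 0) (case_nat 0 (\<lambda>n. Suc (Suc n)))"]
    by simp
  then show ?thesis
    unfolding defterm_def
    by (rule defpred_subst[where P = "\<lambda>x e. e 0 = f x (\<lambda>n. e (Suc n))", OF _ defterm_shift[OF assms(2)]])
qed

lemma defterm_subst1: "defterm (\<lambda>e. f (e 0)) \<Longrightarrow> defterm t \<Longrightarrow> defterm (\<lambda>e. f (t e))"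
  by (rule defterm_subst)

lemma defterm_subst2:
  assumes "defterm (\<lambda>e. f (e 0) (e (Suc 0)))" "defterm t" "defterm u"
  shows "defterm (\<lambda>e. f (t e) (u e))"
proof (rule defterm_subst[where f = "\<lambda>x e. f x (u e)", OF _ assms(2)])
  have "defterm (\<lambda>e. f (e (Suc 0)) (e 0))"
    using defpred_rename[OF assms(1)[unfolded defterm_def],
       of "case_nat 0 (case_nat (Suc (Suc 0)) (case_nat (Suc 0) undefined))"]
    unfolding defterm_def by simp
  then show "defterm (\<lambda>e. f (e 0) (u (\<lambda>n. e (Suc n))))"
    by (rule defterm_subst[where f = "\<lambda>x e. f (e 0) x", OF _ defterm_shift[OF assms(3)]])
qed

lemma defterm_if [definability]:
  assumes "defpred P" "defterm t" "defterm u"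
  shows "defterm (\<lambda>e. if P e then t e else u e)"
proof -
  have "defpred (\<lambda>e. (P (\<lambda>n. e (Suc n)) \<and> e 0 = t (\<lambda>n. e (Suc n))) \<or>
      (\<not> P (\<lambda>n. e (Suc n)) \<and> e 0 = u (\<lambda>n. e (Suc n))))"
    using assms(2,3) unfolding defterm_def
    by (intro defpred_disj defpred_conj defpred_not defpred_rename[OF assms(1), of Suc])
  then show ?thesis
    unfolding defterm_def by (rule back_subst[where P = defpred]) auto
qed


section \<open>Set formation\<close>

definition sep :: "'a \<Rightarrow> ('a \<Rightarrow> bool) \<Rightarrow> 'a" where
  "sep a P = set_of E (\<lambda>x. x \<^bold>\<in> a \<and> P x)"

definition image_set :: "('a \<Rightarrow> 'a) \<Rightarrow> 'a \<Rightarrow> 'a" where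
  "image_set g a = set_of E (\<lambda>y. \<exists>x. x \<^bold>\<in> a \<and> y = g x)"

lemma mem_sep:
  assumes "defpred (\<lambda>e. P (e 0))"
  shows "x \<^bold>\<in> sep a P \<longleftrightarrow> x \<^bold>\<in> a \<and> P x"
proof -
  obtain p ps where p: "\<And>e. P (e 0) \<longleftrightarrow> sat E (interleave e ps) p" using assms by (rule defpredE) blast
  \<comment> \<open>As \<open>P\<close> depends on the variable 0 only, all variables may receive the value \<open>x\<close>.\<close>
  have "sat E (case_nat x ps) (rename (place (\<lambda>_. 0) Suc) p) \<longleftrightarrow> P x" for x
    using p[of "\<lambda>_. x"] by (simp add: sat_rename_place)
  then show ?thesis
    unfolding sep_def using separation[of a ps "rename (place (\<lambda>_. 0) Suc) p"]
    by (intro mem_set_of) simp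
qed

lemma mem_image_set:
  assumes "defterm (\<lambda>e. g (e 0))"
  shows "y \<^bold>\<in> image_set g a \<longleftrightarrow> (\<exists>x. x \<^bold>\<in> a \<and> y = g x)"
proof -
  obtain p ps where p: "\<And>e. e 0 = g (e (Suc 0)) \<longleftrightarrow> sat E (interleave e ps) p"
    using assms unfolding defterm_def by (rule defpredE) blast
  have "sat E (case_nat x (case_nat y ps)) (rename (place (case_nat (Suc 0) (\<lambda>_. 0)) (\<lambda>n. Suc (Suc n))) p)
      \<longleftrightarrow> y = g x" for x y
  proof -
    have "(\<lambda>n. case_nat x (case_nat y ps) (case_nat (Suc 0) (\<lambda>_. 0) n)) = case_nat y (\<lambda>_. x)"
      by (rule ext) (simp split: nat.split)
    then show ?thesis using p[of "case_nat y (\<lambda>_. x)"] by (simp add: sat_rename_place)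
  qed
  then show ?thesis
    unfolding image_set_def
    using replacement[of a ps "rename (place (case_nat (Suc 0) (\<lambda>_. 0)) (\<lambda>n. Suc (Suc n))) p"]
    by (intro mem_set_of) simp
qed

lemma defpred_fix1:
  assumes "defpred (\<lambda>e. P (e 0) (\<lambda>n. e (Suc n)))"
  shows "defpred (\<lambda>e'. P (e' 0) e)"
  using defpred_fix[OF assms, of "Suc 0" "case_nat undefined e"] by simp

lemma defterm_fix1:
  assumes "defterm (\<lambda>e. f (e 0) (\<lambda>n. e (Suc n)))"
  shows "defterm (\<lambda>e'. f (e' 0) e)"
  using defpred_fix[OF assms[unfolded defterm_def], of "Suc (Suc 0)" "case_nat undefined (case_nat undefined e)"]
  unfolding defterm_def by simp

lemma defterm_sep [definability]:
  assumes "defterm a" "defpred (\<lambda>e. P (e 0) (\<lambda>n. e (Suc n)))"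
  shows "defterm (\<lambda>e. sep (a e) (\<lambda>x. P x e))"
proof -
  have *: "s = sep (a e) (\<lambda>x. P x e) \<longleftrightarrow> (\<forall>z. z \<^bold>\<in> s \<longleftrightarrow> z \<^bold>\<in> a e \<and> P z e)" for s e
    by (subst ext_iff) (simp add: mem_sep[OF defpred_fix1[OF assms(2)]])
  have P: "defpred (\<lambda>e. P (e 0) (\<lambda>n. e (Suc (Suc n))))"
    using defpred_rename[OF assms(2), of "case_nat 0 (\<lambda>n. Suc (Suc n))"] by simp
  have a: "defterm (\<lambda>e. a (\<lambda>n. e (Suc (Suc n))))"
    by (rule defterm_rename[OF assms(1)])
  show ?thesis
    unfolding defterm_def[of "\<lambda>e. sep (a e) (\<lambda>x. P x e)"] * by (intro definability a P)
qed

lemma defterm_image_set [definability]: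
  assumes "defterm (\<lambda>e. g (e 0) (\<lambda>n. e (Suc n)))" "defterm a"
  shows "defterm (\<lambda>e. image_set (\<lambda>x. g x e) (a e))"
proof -
  have *: "s = image_set (\<lambda>x. g x e) (a e) \<longleftrightarrow> (\<forall>z. z \<^bold>\<in> s \<longleftrightarrow> (\<exists>x. x \<^bold>\<in> a e \<and> z = g x e))" for s e
    by (subst ext_iff) (simp add: mem_image_set[OF defterm_fix1[OF assms(1)]])
  have g: "defterm (\<lambda>e. g (e 0) (\<lambda>n. e (Suc (Suc (Suc n)))))"
    using defterm_rename[OF assms(1), of "case_nat 0 (\<lambda>n. Suc (Suc (Suc n)))"] by simp
  have a: "defterm (\<lambda>e. a (\<lambda>n. e (Suc (Suc (Suc n)))))"
    by (rule defterm_rename[OF assms(2)])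
  show ?thesis
    unfolding defterm_def[of "\<lambda>e. image_set (\<lambda>x. g x e) (a e)"] * by (intro definability g a)
qed

text \<open>Unlike \<open>THE\<close>, this has a definable value also if there is no unique such element.\<close>

definition the_set :: "('a \<Rightarrow> bool) \<Rightarrow> 'a" where
  "the_set P = (if \<exists>!x. P x then THE x. P x else empty_set E)"

lemma the_set_eq: "P x \<Longrightarrow> (\<And>y. P y \<Longrightarrow> y = x) \<Longrightarrow> the_set P = x"
  unfolding the_set_def by (metis the_equality)

lemma defterm_the_set [definability]:
  assumes "defpred (\<lambda>e. P (e 0) (\<lambda>n. e (Suc n)))"
  shows "defterm (\<lambda>e. the_set (\<lambda>x. P x e))"
proof -
  have *: "s = the_set (\<lambda>x. P x e) \<longleftrightarrow> (P s e \<and> (\<forall>x. P x e \<longrightarrow> x = s)) \<or>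
      (\<not> (\<exists>x. P x e \<and> (\<forall>y. P y e \<longrightarrow> y = x)) \<and> s = empty_set E)" for s e
  proof (cases "\<exists>!x. P x e")
    case True
    then obtain x where "P x e" "\<And>y. P y e \<Longrightarrow> y = x" by auto
    then show ?thesis by (metis the_set_eq[of "\<lambda>x. P x e"])
  next
    case False
    then show ?thesis unfolding the_set_def by (auto simp: Ex1_def)
  qed
  have "defpred (\<lambda>e. P (e 0) (\<lambda>n. e (Suc (r n))))" for r
    using defpred_rename[OF assms, of "case_nat 0 (\<lambda>n. Suc (r n))"] by simp
  note 1 = this[of "Suc"] this[of "\<lambda>n. Suc (Suc n)"]
  show ?thesis
    unfolding defterm_def * by (intro definability assms 1)
qed

declare mem_empty [simp] mem_upair [simp] mem_succ [simp]

lemma eqI: "(\<And>z. z \<^bold>\<in> x \<longleftrightarrow> z \<^bold>\<in> y) \<Longrightarrow> x = y"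
  using extensionality by blast

lemma defpred_definable: "definable P \<Longrightarrow> defpred P"
  unfolding definable_def
  by (elim exE, rule defpredI[where p = "rename (\<lambda>n. 2 * n) p" for p]) (simp add: sat_rename)

lemma defpred_equipotent [definability]: "defterm t \<Longrightarrow> defterm u \<Longrightarrow> defpred (\<lambda>e. equipotent E (t e) (u e))"
  by (rule defpred_subst2[where R = "equipotent E"], rule defpred_definable, rule definable_eqp)

lemma defpred_finite_set [definability]: "defterm t \<Longrightarrow> defpred (\<lambda>e. finite_set E (t e))"
  by (rule defpred_subst1[where P = "finite_set E"]) (unfold finite_set_def, intro definability)

lemma defterm_upair [definability]: "defterm t \<Longrightarrow> defterm u \<Longrightarrow> defterm (\<lambda>e. upair E (t e) (u e))"
  by (rule defterm_subst2[where f = "upair E"]) (unfold defterm_def eq_upair_iff, intro definability)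

lemma defterm_opair [definability]: "defterm t \<Longrightarrow> defterm u \<Longrightarrow> defterm (\<lambda>e. opair E (t e) (u e))"
  unfolding opair_def by (intro definability)

lemma defterm_succ [definability]: "defterm t \<Longrightarrow> defterm (\<lambda>e. succ E (t e))"
  by (rule defterm_subst1[where f = "succ E"]) (unfold defterm_def eq_succ_iff, intro definability)

lemma opair_eq_iff [simp]: "opair E a b = opair E c d \<longleftrightarrow> a = c \<and> b = d"
proof -
  have upair: "upair E x y = upair E u v \<longleftrightarrow> (x = u \<and> y = v) \<or> (x = v \<and> y = u)" for x y u v
    by (subst ext_iff) (simp; metis)
  show ?thesis unfolding opair_def upair by auto
qed

definition subset :: "'a \<Rightarrow> 'a \<Rightarrow> bool" (infix "\<^bold>\<subseteq>" 50) where
  "x \<^bold>\<subseteq> y \<longleftrightarrow> (\<forall>z. z \<^bold>\<in> x \<longrightarrow> z \<^bold>\<in> y)"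

lemma subsetI: "(\<And>z. z \<^bold>\<in> x \<Longrightarrow> z \<^bold>\<in> y) \<Longrightarrow> x \<^bold>\<subseteq> y"
  and subsetD: "x \<^bold>\<subseteq> y \<Longrightarrow> z \<^bold>\<in> x \<Longrightarrow> z \<^bold>\<in> y"
  by (simp_all add: subset_def)

lemma subset_refl [simp]: "x \<^bold>\<subseteq> x"
  and subset_trans: "x \<^bold>\<subseteq> y \<Longrightarrow> y \<^bold>\<subseteq> z \<Longrightarrow> x \<^bold>\<subseteq> z"
  by (simp_all add: subset_def)

lemma defpred_subset [definability]: "defterm t \<Longrightarrow> defterm u \<Longrightarrow> defpred (\<lambda>e. t e \<^bold>\<subseteq> u e)"
  by (rule defpred_subst2[where R = subset]) (unfold subset_def, intro definability)

definition un :: "'a \<Rightarrow> 'a \<Rightarrow> 'a" (infixl "\<^bold>\<union>" 65) where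
  "x \<^bold>\<union> y = set_of E (\<lambda>z. z \<^bold>\<in> x \<or> z \<^bold>\<in> y)"

definition ins :: "'a \<Rightarrow> 'a \<Rightarrow> 'a" where
  "ins a x = x \<^bold>\<union> upair E a a"

definition bigun :: "'a \<Rightarrow> 'a" where
  "bigun x = set_of E (\<lambda>z. \<exists>y. z \<^bold>\<in> y \<and> y \<^bold>\<in> x)"

definition pow :: "'a \<Rightarrow> 'a" where
  "pow x = set_of E (\<lambda>z. z \<^bold>\<subseteq> x)"

lemma mem_un [simp]: "z \<^bold>\<in> x \<^bold>\<union> y \<longleftrightarrow> z \<^bold>\<in> x \<or> z \<^bold>\<in> y"
  unfolding un_def by (rule mem_set_of) (rule ex_un)

lemma mem_ins [simp]: "z \<^bold>\<in> ins a x \<longleftrightarrow> z = a \<or> z \<^bold>\<in> x"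
  unfolding ins_def by auto

lemma mem_bigun [simp]: "z \<^bold>\<in> bigun x \<longleftrightarrow> (\<exists>y. z \<^bold>\<in> y \<and> y \<^bold>\<in> x)"
  unfolding bigun_def by (rule mem_set_of) (rule union)

lemma mem_pow [simp]: "z \<^bold>\<in> pow x \<longleftrightarrow> z \<^bold>\<subseteq> x"
  unfolding pow_def subset_def by (rule mem_set_of) (rule powerset)

lemma defterm_un [definability]: "defterm t \<Longrightarrow> defterm u \<Longrightarrow> defterm (\<lambda>e. t e \<^bold>\<union> u e)"
  by (rule defterm_subst2[where f = un]) (unfold defterm_def ext_iff[of _ "_ \<^bold>\<union> _"] mem_un, intro definability)

lemma defterm_ins [definability]: "defterm t \<Longrightarrow> defterm u \<Longrightarrow> defterm (\<lambda>e. ins (t e) (u e))"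
  unfolding ins_def by (intro definability)

lemma defterm_bigun [definability]: "defterm t \<Longrightarrow> defterm (\<lambda>e. bigun (t e))"
  by (rule defterm_subst1[where f = bigun]) (unfold defterm_def ext_iff[of _ "bigun _"] mem_bigun, intro definability)

lemma defterm_pow [definability]: "defterm t \<Longrightarrow> defterm (\<lambda>e. pow (t e))"
  by (rule defterm_subst1[where f = pow]) (unfold defterm_def ext_iff[of _ "pow _"] mem_pow, intro definability)

definition prod :: "'a \<Rightarrow> 'a \<Rightarrow> 'a" where
  "prod A B = sep (pow (pow (A \<^bold>\<union> B))) (\<lambda>p. \<exists>x y. x \<^bold>\<in> A \<and> y \<^bold>\<in> B \<and> p = opair E x y)"

lemma mem_prod: "p \<^bold>\<in> prod A B \<longleftrightarrow> (\<exists>x y. x \<^bold>\<in> A \<and> y \<^bold>\<in> B \<and> p = opair E x y)"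
proof -
  have "p \<^bold>\<in> prod A B \<longleftrightarrow> p \<^bold>\<in> pow (pow (A \<^bold>\<union> B)) \<and> (\<exists>x y. x \<^bold>\<in> A \<and> y \<^bold>\<in> B \<and> p = opair E x y)"
    unfolding prod_def by (rule mem_sep) (intro definability)
  then show ?thesis by (auto simp: subset_def opair_def)
qed

lemma opair_mem_prod [simp]: "opair E x y \<^bold>\<in> prod A B \<longleftrightarrow> x \<^bold>\<in> A \<and> y \<^bold>\<in> B"
  by (auto simp: mem_prod)

lemma defterm_prod [definability]: "defterm t \<Longrightarrow> defterm u \<Longrightarrow> defterm (\<lambda>e. prod (t e) (u e))"
  by (rule defterm_subst2[where f = prod]) (unfold prod_def, intro definability)


section \<open>Definable functions and functions of the model\<close>

abbreviation defun :: "('a \<Rightarrow> 'a) \<Rightarrow> bool" where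
  "defun g \<equiv> defterm (\<lambda>e. g (e 0))"

abbreviation elts :: "'a \<Rightarrow> 'a set" where
  "elts A \<equiv> {x. x \<^bold>\<in> A}"

text \<open>
  Application is total, so that an arbitrary element \<open>f\<close> of the model acts as a definable function.
  Conversely \<open>graph\<close> turns a definable HOL function on a set into a function of the model. The proofs
  use definable HOL functions and the HOL notions \<open>inj_on\<close> and \<open>bij_betw\<close>; functions of the
  model occur where a quantifier over functions has to be definable.
\<close>

definition app :: "'a \<Rightarrow> 'a \<Rightarrow> 'a" where
  "app f x = the_set (\<lambda>y. opair E x y \<^bold>\<in> f)"

lemma defterm_app [definability]: "defterm t \<Longrightarrow> defterm u \<Longrightarrow> defterm (\<lambda>e. app (t e) (u e))"
  by (rule defterm_subst2[where f = app]) (unfold app_def, intro definability)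

lemma defun_app: "defun (app f)"
  by (intro definability)

lemma app_eq:
  assumes "is_function E f A B" "opair E x y \<^bold>\<in> f"
  shows "app f x = y"
  unfolding app_def
proof (rule the_set_eq)
  have "x \<^bold>\<in> A" using assms unfolding is_function_def by fastforce
  then show "y' = y" if "opair E x y' \<^bold>\<in> f" for y'
    using assms that unfolding is_function_def by blast
qed (rule assms)

lemma opair_app:
  assumes "is_function E f A B" "x \<^bold>\<in> A"
  shows "opair E x (app f x) \<^bold>\<in> f"
  using app_eq[OF assms(1)] assms unfolding is_function_def by metis

lemma app_mem:
  assumes "is_function E f A B" "x \<^bold>\<in> A"
  shows "app f x \<^bold>\<in> B"
  using opair_app[OF assms] assms unfolding is_function_def by fastforce

lemma function_eqI:
  assumes "is_function E f A B" "is_function E g A C" "\<And>x. x \<^bold>\<in> A \<Longrightarrow> app f x = app g x"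
  shows "f = g"
proof -
  have sub: "p \<^bold>\<in> k"
    if h: "is_function E h A B" and k: "is_function E k A C" "\<And>x. x \<^bold>\<in> A \<Longrightarrow> app h x = app k x"
      and p: "p \<^bold>\<in> h"
    for h k p B C
  proof -
    obtain x y where "x \<^bold>\<in> A" "p = opair E x y" using h p unfolding is_function_def by blast
    then show ?thesis using h k p app_eq opair_app by metis
  qed
  show ?thesis
    by (rule eqI) (use sub[of f B g C] sub[of g C f B] assms in metis)
qed

definition graph :: "('a \<Rightarrow> 'a) \<Rightarrow> 'a \<Rightarrow> 'a" where
  "graph g A = image_set (\<lambda>x. opair E x (g x)) A"

lemma defterm_graph [definability]:
  assumes "defterm (\<lambda>e. g (e 0) (\<lambda>n. e (Suc n)))" "defterm a"
  shows "defterm (\<lambda>e. graph (\<lambda>x. g x e) (a e))"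
  unfolding graph_def by (intro definability assms)

lemma mem_graph: "defun g \<Longrightarrow> p \<^bold>\<in> graph g A \<longleftrightarrow> (\<exists>x. x \<^bold>\<in> A \<and> p = opair E x (g x))"
  unfolding graph_def by (rule mem_image_set) (intro definability)

lemma is_function_graph:
  assumes "defun g" "\<And>x. x \<^bold>\<in> A \<Longrightarrow> g x \<^bold>\<in> B"
  shows "is_function E (graph g A) A B"
  unfolding is_function_def mem_graph[OF assms(1)] using assms(2) by auto

lemma app_graph:
  assumes "defun g" "x \<^bold>\<in> A"
  shows "app (graph g A) x = g x"
  by (rule app_eq[of _ A "image_set g A"])
    (use assms in \<open>auto intro!: is_function_graph simp: mem_graph mem_image_set\<close>)

lemma defun_comp:
  assumes "defun g" "defun h"
  shows "defun (\<lambda>x. g (h x))"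
  by (rule defterm_subst1[OF assms(1), where t = "\<lambda>e. h (e 0)"]) (rule assms(2))

lemma ex_defun_inverse:
  assumes "defun g" "inj_on g (elts A)"
  obtains h where "defun h" "\<And>x. x \<^bold>\<in> A \<Longrightarrow> h (g x) = x"
proof
  show "defun (\<lambda>y. the_set (\<lambda>x. x \<^bold>\<in> A \<and> y = g x))"
    by (intro definability defterm_subst1[OF assms(1)])
  show "the_set (\<lambda>x'. x' \<^bold>\<in> A \<and> g x = g x') = x" if "x \<^bold>\<in> A" for x
    by (rule the_set_eq) (use assms(2) that in \<open>auto dest: inj_onD\<close>)
qed

lemma equipotent_iff_defun:
  "equipotent E A B \<longleftrightarrow> (\<exists>g. defun g \<and> bij_betw g (elts A) (elts B))"
proof
  assume "equipotent E A B"
  then obtain f where f: "is_function E f A B" "\<forall>y. y \<^bold>\<in> B \<longrightarrow> (\<exists>!x. opair E x y \<^bold>\<in> f)"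
    unfolding equipotent_def is_bijection_def by blast
  have "bij_betw (app f) (elts A) (elts B)"
  proof (rule bij_betw_imageI)
    show "inj_on (app f) (elts A)"
      using f(2) opair_app[OF f(1)] app_mem[OF f(1)] by (intro inj_onI) (metis mem_Collect_eq)
    have "y \<in> app f ` elts A" if y: "y \<^bold>\<in> B" for y
    proof -
      obtain x where x: "opair E x y \<^bold>\<in> f" using f(2) y by blast
      then have "x \<^bold>\<in> A" using f(1) unfolding is_function_def by fastforce
      then show ?thesis using app_eq[OF f(1) x] by blast
    qed
    then show "app f ` elts A = elts B" using app_mem[OF f(1)] by auto
  qed
  then show "\<exists>g. defun g \<and> bij_betw g (elts A) (elts B)" using defun_app by blast
next
  assume "\<exists>g. defun g \<and> bij_betw g (elts A) (elts B)"
  then obtain g where g: "defun g" "bij_betw g (elts A) (elts B)" by blast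
  have "is_function E (graph g A) A B"
    by (rule is_function_graph) (use g bij_betwE in auto)
  moreover have "\<exists>!x. opair E x y \<^bold>\<in> graph g A" if y: "y \<^bold>\<in> B" for y
  proof -
    have "y \<in> g ` elts A" using g(2) y by (simp add: bij_betw_def)
    then obtain x where x: "x \<^bold>\<in> A" "y = g x" by blast
    have "x' = x" if "x' \<^bold>\<in> A" "y = g x'" for x'
      using inj_onD[OF bij_betw_imp_inj_on[OF g(2)], of x' x] x that by simp
    then show ?thesis using x unfolding mem_graph[OF g(1)] opair_eq_iff by blast
  qed
  ultimately show "equipotent E A B" unfolding equipotent_def is_bijection_def by blast
qed

lemma equipotentI: "defun g \<Longrightarrow> bij_betw g (elts A) (elts B) \<Longrightarrow> equipotent E A B"
  unfolding equipotent_iff_defun by (intro exI[of _ g] conjI)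

lemma equipotentE:
  assumes "equipotent E A B"
  obtains g where "defun g" "bij_betw g (elts A) (elts B)"
  using assms unfolding equipotent_iff_defun by (elim exE conjE)


section \<open>Finite sets\<close>

lemma finite_setI: "n \<^bold>\<in> omega E \<Longrightarrow> equipotent E A n \<Longrightarrow> finite_set E A"
  unfolding finite_set_def by blast

lemma finite_setE:
  assumes "finite_set E A"
  obtains n where "n \<^bold>\<in> omega E" "equipotent E A n"
  using assms unfolding finite_set_def by blast

lemma mem_irrefl [simp]: "\<not> x \<^bold>\<in> x"
  using foundation[of "upair E x x"] by auto

lemma zero_omega [simp]: "empty_set E \<^bold>\<in> omega E"
  by (simp add: mem_omega is_inductive_def)

lemma succ_omega [simp]: "n \<^bold>\<in> omega E \<Longrightarrow> succ E n \<^bold>\<in> omega E"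
  by (simp add: mem_omega is_inductive_def)

text \<open>
  Since \<open>\<omega>\<close> is the least inductive set only among the sets of the model, induction is restricted to definable predicates.
\<close>

lemma omega_induct:
  assumes "n \<^bold>\<in> omega E" "defpred (\<lambda>e. P (e 0))" "P (empty_set E)"
    and "\<And>m. m \<^bold>\<in> omega E \<Longrightarrow> P m \<Longrightarrow> P (succ E m)"
  shows "P n"
proof -
  have "is_inductive E (sep (omega E) P)"
    using assms(3,4) by (simp add: is_inductive_def mem_sep[OF assms(2)])
  then have "n \<^bold>\<in> sep (omega E) P" using assms(1) mem_omega by blast
  then show ?thesis by (simp add: mem_sep[OF assms(2)])
qed

definition remove :: "'a \<Rightarrow> 'a \<Rightarrow> 'a" where
  "remove a S = sep S (\<lambda>x. x \<noteq> a)"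

lemma mem_remove [simp]: "x \<^bold>\<in> remove a S \<longleftrightarrow> x \<^bold>\<in> S \<and> x \<noteq> a"
  unfolding remove_def by (rule mem_sep) (intro definability)

lemma defterm_remove [definability]: "defterm t \<Longrightarrow> defterm u \<Longrightarrow> defterm (\<lambda>e. remove (t e) (u e))"
  by (rule defterm_subst2[where f = remove]) (unfold remove_def, intro definability)

lemma ins_remove: "a \<^bold>\<in> S \<Longrightarrow> ins a (remove a S) = S"
  by (rule eqI) auto

lemma finite_omega: "n \<^bold>\<in> omega E \<Longrightarrow> finite_set E n"
  by (rule finite_setI, assumption, rule equipotentI[of "\<lambda>x. x"]) (simp_all add: defterm_var bij_betw_def)

lemma finite_empty [simp]: "finite_set E (empty_set E)"
  by (rule finite_omega) simp

lemma finite_ins [simp]: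
  assumes "finite_set E A"
  shows "finite_set E (ins a A)"
proof (cases "a \<^bold>\<in> A")
  case True
  then have "ins a A = A" by (intro eqI) auto
  then show ?thesis using assms by simp
next
  case False
  obtain n where n: "n \<^bold>\<in> omega E" "equipotent E A n" using assms(1) by (rule finite_setE)
  obtain g where g: "defun g" "bij_betw g (elts A) (elts n)" using n(2) by (rule equipotentE)
  let ?h = "\<lambda>x. if x = a then n else g x"
  have "defun ?h" by (intro definability defterm_subst1[OF g(1)])
  moreover have "bij_betw ?h (elts (ins a A)) (elts (succ E n))"
  proof -
    have "bij_betw ?h (elts A \<union> {a}) (elts n \<union> {n})"
      using False by (intro bij_betw_combine bij_betw_singletonI, subst bij_betw_cong[of _ _ g])
        (auto intro: g(2))
    moreover have "elts (ins a A) = elts A \<union> {a}" "elts (succ E n) = elts n \<union> {n}" by auto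
    ultimately show ?thesis by simp
  qed
  ultimately show ?thesis
    by (rule finite_setI[OF succ_omega[OF n(1)] equipotentI])
qed

lemma finite_induct [consumes 1, case_names definable empty ins]:
  assumes "finite_set E A" "defpred (\<lambda>e. P (e 0))" "P (empty_set E)"
    and ins: "\<And>S a. finite_set E S \<Longrightarrow> \<not> a \<^bold>\<in> S \<Longrightarrow> P S \<Longrightarrow> P (ins a S)"
  shows "P A"
proof -
  obtain n where n: "n \<^bold>\<in> omega E" "equipotent E A n" using assms(1) unfolding finite_set_def by blast
  have "\<forall>A. equipotent E A n \<longrightarrow> P A"
    using n(1)
  proof (rule omega_induct)
    show "defpred (\<lambda>e. \<forall>A. equipotent E A (e 0) \<longrightarrow> P A)"
      by (intro definability defpred_subst1[OF assms(2)])
    have "A = empty_set E" if "equipotent E A (empty_set E)" for A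
      using that by (elim equipotentE, intro eqI) (auto simp: bij_betw_def)
    then show "\<forall>A. equipotent E A (empty_set E) \<longrightarrow> P A" using assms(3) by blast
    fix m assume m: "m \<^bold>\<in> omega E" and IH: "\<forall>A. equipotent E A m \<longrightarrow> P A"
    show "\<forall>A. equipotent E A (succ E m) \<longrightarrow> P A"
    proof (intro allI impI)
      fix A assume "equipotent E A (succ E m)"
      then obtain g where g: "defun g" "bij_betw g (elts A) (elts (succ E m))"
        by (rule equipotentE)
      then obtain a where a: "a \<^bold>\<in> A" "g a = m"
        by (metis (mono_tags) bij_betw_imp_surj_on imageE mem_Collect_eq mem_succ)
      have "bij_betw g (elts A - {a}) (elts (succ E m) - {m})"
        using bij_betw_DiffI[OF g(2), of "{a}" "{m}"] a by auto
      moreover have "elts A - {a} = elts (remove a A)" "elts (succ E m) - {m} = elts m" by auto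
      ultimately have *: "equipotent E (remove a A) m"
        using equipotentI[OF g(1)] by simp
      then have "P (ins a (remove a A))"
        using IH m by (intro ins) (auto simp: finite_set_def)
      then show "P A" by (simp add: ins_remove[OF a(1)])
    qed
  qed
  then show ?thesis using n(2) by blast
qed

text \<open>
  In inductions over finite sets, the statement for all subsets, or for all values of a second argument, is expressed by
  a quantifier inside the predicate, because the predicate must be definable.
\<close>

lemma finite_subset:
  assumes "finite_set E S" "T \<^bold>\<subseteq> S"
  shows "finite_set E T"
proof -
  have "\<forall>T. T \<^bold>\<subseteq> S \<longrightarrow> finite_set E T"
    using assms(1)
  proof (induction rule: finite_induct)
    case definable show ?case by (intro definability)
  next
    case empty
    have "T = empty_set E" if "T \<^bold>\<subseteq> empty_set E" for T
      using that by (intro eqI) (auto simp: subset_def)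
    then show ?case using finite_empty by metis
  next
    case (ins S a)
    show ?case
    proof (intro allI impI)
      fix T assume T: "T \<^bold>\<subseteq> ins a S"
      have "remove a T \<^bold>\<subseteq> S" using T by (auto simp: subset_def)
      then have "finite_set E (ins a (remove a T))" "finite_set E (remove a T)" using ins by auto
      moreover have "remove a T = T" if "\<not> a \<^bold>\<in> T" using that by (intro eqI) auto
      ultimately show "finite_set E T" using ins_remove by metis
    qed
  qed
  then show ?thesis using assms(2) by blast
qed

lemma finite_image_set:
  assumes "finite_set E S" "defun g"
  shows "finite_set E (image_set g S)"
  using assms(1)
proof (induction rule: finite_induct)
  case definable show ?case by (intro definability defterm_subst1[OF assms(2)])
next
  case empty
  have "image_set g (empty_set E) = empty_set E"
    by (rule eqI) (simp add: mem_image_set[OF assms(2)])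
  then show ?case by simp
next
  case (ins S a)
  have "image_set g (ins a S) = ins (g a) (image_set g S)"
    by (rule eqI) (auto simp: mem_image_set[OF assms(2)])
  then show ?case using ins by simp
qed

lemma finite_surj:
  assumes "finite_set E S" "defun g" "elts T \<subseteq> g ` elts S"
  shows "finite_set E T"
  by (rule finite_subset[OF finite_image_set[OF assms(1,2)]])
    (use assms(3) in \<open>auto simp: subset_def mem_image_set[OF assms(2)]\<close>)

lemma finite_un [simp]:
  assumes "finite_set E S" "finite_set E T"
  shows "finite_set E (S \<^bold>\<union> T)"
  using assms(1)
proof (induction rule: finite_induct)
  case definable show ?case by (intro definability)
next
  case empty
  have "empty_set E \<^bold>\<union> T = T" by (rule eqI) simp
  then show ?case using assms(2) by simp
next
  case (ins S a)
  have "ins a S \<^bold>\<union> T = ins a (S \<^bold>\<union> T)" by (rule eqI) auto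
  then show ?case using ins by simp
qed

lemma finite_bigun:
  assumes "finite_set E S" "\<And>x. x \<^bold>\<in> S \<Longrightarrow> finite_set E x"
  shows "finite_set E (bigun S)"
proof -
  have "(\<forall>x. x \<^bold>\<in> S \<longrightarrow> finite_set E x) \<longrightarrow> finite_set E (bigun S)"
    using assms(1)
  proof (induction rule: finite_induct)
    case definable show ?case by (intro definability)
  next
    case empty
    have "bigun (empty_set E) = empty_set E" by (rule eqI) simp
    then show ?case by simp
  next
    case (ins S a)
    have "bigun (ins a S) = a \<^bold>\<union> bigun S" by (rule eqI) auto
    then show ?case using ins by simp
  qed
  then show ?thesis using assms(2) by blast
qed

lemma finite_pow:
  assumes "finite_set E S"
  shows "finite_set E (pow S)"
  using assms(1)
proof (induction rule: finite_induct)
  case definable show ?case by (intro definability)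
next
  case empty
  have "pow (empty_set E) = ins (empty_set E) (empty_set E)"
    by (rule eqI) (simp add: subset_def eq_empty_iff)
  then show ?case by simp
next
  case (ins S a)
  have d: "defun (ins a)" by (intro definability)
  have "T \<^bold>\<in> pow S \<^bold>\<union> image_set (ins a) (pow S)" if T: "T \<^bold>\<subseteq> ins a S" for T
  proof (cases "a \<^bold>\<in> T")
    case True
    have "remove a T \<^bold>\<subseteq> S" using T by (auto simp: subset_def)
    then show ?thesis using ins_remove[OF True] by (auto simp: mem_image_set[OF d] intro!: exI[of _ "remove a T"])
  next
    case False
    then show ?thesis using T by (auto simp: subset_def)
  qed
  then have "pow (ins a S) \<^bold>\<subseteq> pow S \<^bold>\<union> image_set (ins a) (pow S)"
    by (intro subsetI) simp
  then show ?case using finite_subset finite_un[OF ins(3) finite_image_set[OF ins(3) d]] by blast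
qed

lemma finite_prod:
  assumes "finite_set E S" "finite_set E T"
  shows "finite_set E (prod S T)"
proof (rule finite_subset)
  show "finite_set E (pow (pow (S \<^bold>\<union> T)))" using assms by (intro finite_pow finite_un)
  show "prod S T \<^bold>\<subseteq> pow (pow (S \<^bold>\<union> T))" by (auto simp: subset_def mem_prod opair_def)
qed


section \<open>Parity of finite sets\<close>

text \<open>
  On the subsets of a finite set, the family of the subsets of odd size is the only one that omits the
  empty set and changes membership with every added element. This avoids
  arithmetic in \<open>\<omega>\<close>.
\<close>

definition parity_family :: "'a \<Rightarrow> 'a \<Rightarrow> bool" where
  "parity_family F S \<longleftrightarrow> \<not> empty_set E \<^bold>\<in> F \<and>
     (\<forall>T a. T \<^bold>\<subseteq> S \<and> a \<^bold>\<in> S \<and> \<not> a \<^bold>\<in> T \<longrightarrow> (ins a T \<^bold>\<in> F \<longleftrightarrow> \<not> T \<^bold>\<in> F))"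

definition odd_set :: "'a \<Rightarrow> bool" where
  "odd_set S \<longleftrightarrow> (\<exists>F. parity_family F S \<and> S \<^bold>\<in> F)"

lemma defpred_parity_family [definability]: "defterm t \<Longrightarrow> defterm u \<Longrightarrow> defpred (\<lambda>e. parity_family (t e) (u e))"
  by (rule defpred_subst2[where R = parity_family]) (unfold parity_family_def, intro definability)

lemma defpred_odd_set [definability]: "defterm t \<Longrightarrow> defpred (\<lambda>e. odd_set (t e))"
  by (rule defpred_subst1[where P = odd_set]) (unfold odd_set_def, intro definability)

lemma parity_family_subset: "parity_family F S \<Longrightarrow> T \<^bold>\<subseteq> S \<Longrightarrow> parity_family F T"
  unfolding parity_family_def by (meson subsetD subset_trans)

lemma parity_family_ins:
  "parity_family F S \<Longrightarrow> T \<^bold>\<subseteq> S \<Longrightarrow> a \<^bold>\<in> S \<Longrightarrow> \<not> a \<^bold>\<in> T \<Longrightarrow> ins a T \<^bold>\<in> F \<longleftrightarrow> \<not> T \<^bold>\<in> F"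
  unfolding parity_family_def by blast

lemma parity_family_unique:
  assumes "finite_set E S" "parity_family F S" "parity_family G S"
  shows "S \<^bold>\<in> F \<longleftrightarrow> S \<^bold>\<in> G"
proof -
  have "parity_family F S \<and> parity_family G S \<longrightarrow> (S \<^bold>\<in> F \<longleftrightarrow> S \<^bold>\<in> G)"
    using assms(1)
  proof (induction rule: finite_induct)
    case definable show ?case by (intro definability)
  next
    case empty show ?case by (auto simp: parity_family_def)
  next
    case (ins S a)
    have sub: "S \<^bold>\<subseteq> ins a S" and mem: "a \<^bold>\<in> ins a S" by (simp_all add: subset_def)
    show ?case
      using ins(2,3) parity_family_subset[OF _ sub] parity_family_ins[OF _ sub mem] by blast
  qed
  then show ?thesis using assms by blast
qed

text \<open>
  A family for \<open>S\<close> extends to one for \<open>S\<close> with a new element \<open>a\<close>: a set that contains \<open>a\<close> has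
  the parity opposite to that of its trace on \<open>S\<close>.
\<close>

lemma ex_parity_family:
  assumes "finite_set E S"
  shows "\<exists>F. parity_family F S"
  using assms
proof (induction rule: finite_induct)
  case definable show ?case by (intro definability)
next
  case empty
  show ?case by (rule exI[of _ "empty_set E"]) (simp add: parity_family_def)
next
  case (ins S a)
  then obtain F where F: "parity_family F S" by blast
  define G where "G = sep (pow (ins a S)) (\<lambda>T. remove a T \<^bold>\<in> F \<longleftrightarrow> \<not> a \<^bold>\<in> T)"
  have G: "T \<^bold>\<in> G \<longleftrightarrow> T \<^bold>\<subseteq> ins a S \<and> (remove a T \<^bold>\<in> F \<longleftrightarrow> \<not> a \<^bold>\<in> T)" for T
    unfolding G_def by (subst mem_sep) (intro definability, simp)
  have "parity_family G (ins a S)"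
    unfolding parity_family_def
  proof (intro conjI allI impI)
    have "remove a (empty_set E) = empty_set E" by (rule eqI) simp
    then show "\<not> empty_set E \<^bold>\<in> G" using F by (simp add: G parity_family_def)
  next
    fix T b assume *: "T \<^bold>\<subseteq> ins a S \<and> b \<^bold>\<in> ins a S \<and> \<not> b \<^bold>\<in> T"
    then have sub: "ins b T \<^bold>\<subseteq> ins a S" by (auto simp: subset_def)
    show "ins b T \<^bold>\<in> G \<longleftrightarrow> \<not> T \<^bold>\<in> G"
    proof (cases "b = a")
      case True
      have "remove a (ins a T) = T" "remove a T = T" using * True by (auto intro!: eqI)
      then show ?thesis using * True sub by (auto simp: G)
    next
      case False
      have eq: "remove a (ins b T) = ins b (remove a T)" using False by (intro eqI) auto
      have "remove a T \<^bold>\<subseteq> S" "b \<^bold>\<in> S" "\<not> b \<^bold>\<in> remove a T" using * False by (auto simp: subset_def)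
      then have "ins b (remove a T) \<^bold>\<in> F \<longleftrightarrow> \<not> remove a T \<^bold>\<in> F" by (rule parity_family_ins[OF F])
      then show ?thesis using * False sub unfolding G eq by auto
    qed
  qed
  then show ?case by blast
qed

lemma odd_set_iff: "finite_set E S \<Longrightarrow> parity_family F S \<Longrightarrow> odd_set S \<longleftrightarrow> S \<^bold>\<in> F"
  unfolding odd_set_def using parity_family_unique by blast

lemma odd_set_empty [simp]: "\<not> odd_set (empty_set E)"
  unfolding odd_set_def parity_family_def by blast

lemma odd_set_ins:
  assumes "finite_set E S" "\<not> a \<^bold>\<in> S"
  shows "odd_set (ins a S) \<longleftrightarrow> \<not> odd_set S"
proof -
  obtain F where F: "parity_family F (ins a S)" using ex_parity_family finite_ins[OF assms(1)] by blast
  have sub: "S \<^bold>\<subseteq> ins a S" and mem: "a \<^bold>\<in> ins a S" by (simp_all add: subset_def)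
  show ?thesis
    unfolding odd_set_iff[OF assms(1) parity_family_subset[OF F sub]] odd_set_iff[OF finite_ins[OF assms(1)] F]
    by (rule parity_family_ins[OF F sub mem assms(2)])
qed

text \<open>
  Additivity of parity modulo 2, the only law of counting that inclusion and exclusion needs: symmetric
  differences become sums.
\<close>

lemma odd_set_sep_neq:
  assumes "finite_set E S" and P: "defpred (\<lambda>e. P (e 0))" and Q: "defpred (\<lambda>e. Q (e 0))"
  shows "odd_set (sep S (\<lambda>x. \<not> (P x \<longleftrightarrow> Q x))) \<longleftrightarrow> \<not> (odd_set (sep S P) \<longleftrightarrow> odd_set (sep S Q))"
proof -
  have PQ: "defpred (\<lambda>e. \<not> (P (e 0) \<longleftrightarrow> Q (e 0)))" by (intro definability P Q)
  show ?thesis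
    using assms(1)
  proof (induction rule: finite_induct)
    case definable
    show ?case by (intro definability defpred_subst1[OF P] defpred_subst1[OF Q])
  next
    case empty
    have "sep (empty_set E) R = empty_set E" if "defpred (\<lambda>e. R (e 0))" for R
      by (rule eqI) (simp add: mem_sep[OF that])
    then show ?case using PQ P Q by simp
  next
    case (ins S a)
    have "odd_set (sep (ins a S) R) \<longleftrightarrow> \<not> (odd_set (sep S R) \<longleftrightarrow> R a)" if R: "defpred (\<lambda>e. R (e 0))" for R
    proof (cases "R a")
      case True
      then have "sep (ins a S) R = ins a (sep S R)" by (intro eqI) (auto simp: mem_sep[OF R])
      moreover have "finite_set E (sep S R)" "\<not> a \<^bold>\<in> sep S R"
        using ins(1,2) by (auto intro: finite_subset simp: mem_sep[OF R] subset_def)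
      ultimately show ?thesis using True by (simp add: odd_set_ins)
    next
      case False
      then have "sep (ins a S) R = sep S R" by (intro eqI) (auto simp: mem_sep[OF R])
      then show ?thesis using False by simp
    qed
    from this[OF PQ] this[OF P] this[OF Q] show ?case using ins(3) by blast
  qed
qed


section \<open>Minimal elements, surjections and the pigeonhole principle\<close>

lemma finite_minimal:
  assumes "finite_set E S" "a \<^bold>\<in> S" and R: "defpred (\<lambda>e. R (e 0) (e (Suc 0)))"
    and trans: "\<And>x y z. x \<^bold>\<in> S \<Longrightarrow> y \<^bold>\<in> S \<Longrightarrow> z \<^bold>\<in> S \<Longrightarrow> R x y \<Longrightarrow> R y z \<Longrightarrow> R x z"
    and antisym: "\<And>x y. x \<^bold>\<in> S \<Longrightarrow> y \<^bold>\<in> S \<Longrightarrow> R x y \<Longrightarrow> R y x \<Longrightarrow> x = y"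
  obtains m where "m \<^bold>\<in> S" "\<And>x. x \<^bold>\<in> S \<Longrightarrow> R x m \<Longrightarrow> x = m"
proof -
  have "S \<^bold>\<subseteq> S \<longrightarrow> (\<exists>a. a \<^bold>\<in> S) \<longrightarrow> (\<exists>m. m \<^bold>\<in> S \<and> (\<forall>x. x \<^bold>\<in> S \<and> R x m \<longrightarrow> x = m))"
    using assms(1)
  proof (induction "S" rule: finite_induct[where P = "\<lambda>T. T \<^bold>\<subseteq> S \<longrightarrow> (\<exists>a. a \<^bold>\<in> T) \<longrightarrow>
        (\<exists>m. m \<^bold>\<in> T \<and> (\<forall>x. x \<^bold>\<in> T \<and> R x m \<longrightarrow> x = m))"])
    case definable show ?case by (intro definability defpred_subst2[OF R])
  next
    case empty show ?case by simp
  next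
    case (ins T a)
    show ?case
    proof (intro impI)
      assume sub: "ins a T \<^bold>\<subseteq> S"
      have S: "x \<^bold>\<in> S" if "x = a \<or> x \<^bold>\<in> T" for x using subsetD[OF sub] that by simp
      show "\<exists>m. m \<^bold>\<in> ins a T \<and> (\<forall>x. x \<^bold>\<in> ins a T \<and> R x m \<longrightarrow> x = m)"
      proof (cases "\<exists>b. b \<^bold>\<in> T")
        case False
        then show ?thesis by (intro exI[of _ a]) auto
      next
        case True
        moreover have "T \<^bold>\<subseteq> S" using S by (intro subsetI) simp
        ultimately obtain m where m: "m \<^bold>\<in> T" "\<And>x. x \<^bold>\<in> T \<Longrightarrow> R x m \<Longrightarrow> x = m"
          using ins(3) by blast
        show ?thesis
        proof (cases "R a m")
          case True
          have "x = a" if x: "x \<^bold>\<in> T" "R x a" for x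
          proof -
            have "R x m" using x True S m(1) by (intro trans[of x a m]) simp_all
            then have "x = m" using m(2) x(1) by simp
            then show ?thesis using antisym[of a m] x True S m(1) by simp
          qed
          then show ?thesis by (intro exI[of _ a]) auto
        next
          case False
          then show ?thesis using m by (intro exI[of _ m]) auto
        qed
      qed
    qed
  qed
  then show ?thesis using assms(2) that by auto
qed

text \<open>
  Comparison of sizes by surjections. Without choice it is weaker than comparison by injections, and it is
  the form in which sizes are bounded below: a set that meets each member of a family of
  disjoint sets is mapped onto the index set, without choosing representatives. As \<open>f\<close> may also
  take values outside \<open>T\<close>, the relation is evidently monotone in \<open>S\<close> and antitone in \<open>T\<close>.
\<close>

definition covered_by :: "'a \<Rightarrow> 'a \<Rightarrow> bool" (infix "\<^bold>\<preceq>" 50) where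
  "T \<^bold>\<preceq> S \<longleftrightarrow> (\<exists>f. \<forall>t. t \<^bold>\<in> T \<longrightarrow> (\<exists>s. s \<^bold>\<in> S \<and> t = app f s))"

lemma defpred_covered_by [definability]: "defterm t \<Longrightarrow> defterm u \<Longrightarrow> defpred (\<lambda>e. t e \<^bold>\<preceq> u e)"
  by (rule defpred_subst2[where R = covered_by]) (unfold covered_by_def, intro definability)

lemma covered_byI:
  assumes "defun g" "\<And>t. t \<^bold>\<in> T \<Longrightarrow> \<exists>s. s \<^bold>\<in> S \<and> t = g s"
  shows "T \<^bold>\<preceq> S"
  unfolding covered_by_def using assms(2) app_graph[OF assms(1)] by (intro exI[of _ "graph g S"]) metis

lemma covered_byE:
  assumes "T \<^bold>\<preceq> S"
  obtains g where "defun g" "\<And>t. t \<^bold>\<in> T \<Longrightarrow> \<exists>s. s \<^bold>\<in> S \<and> t = g s"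
proof -
  obtain f where "\<forall>t. t \<^bold>\<in> T \<longrightarrow> (\<exists>s. s \<^bold>\<in> S \<and> t = app f s)" using assms unfolding covered_by_def ..
  then show thesis by (intro that[of "app f"] defun_app) blast
qed

lemma covered_by_trans:
  assumes "R \<^bold>\<preceq> S" "S \<^bold>\<preceq> T"
  shows "R \<^bold>\<preceq> T"
proof -
  obtain g where g: "defun g" "\<And>t. t \<^bold>\<in> R \<Longrightarrow> \<exists>s. s \<^bold>\<in> S \<and> t = g s" using assms(1) by (rule covered_byE) blast
  obtain h where h: "defun h" "\<And>t. t \<^bold>\<in> S \<Longrightarrow> \<exists>s. s \<^bold>\<in> T \<and> t = h s" using assms(2) by (rule covered_byE) blast
  show ?thesis
    by (rule covered_byI[OF defun_comp[OF g(1) h(1)]]) (use g(2) h(2) in blast)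
qed

lemma covered_by_subset: "R \<^bold>\<subseteq> S \<Longrightarrow> R \<^bold>\<preceq> S"
  by (rule covered_byI[of "\<lambda>x. x"]) (auto intro: definability dest: subsetD)

lemma covered_by_inj:
  assumes "defun g" "inj_on g (elts T)" "\<And>t. t \<^bold>\<in> T \<Longrightarrow> g t \<^bold>\<in> S"
  shows "T \<^bold>\<preceq> S"
proof -
  obtain h where "defun h" "\<And>x. x \<^bold>\<in> T \<Longrightarrow> h (g x) = x" using assms(1,2) by (rule ex_defun_inverse) blast
  then show ?thesis using assms(3) by (intro covered_byI[of h]) metis+
qed

lemma pigeonhole:
  assumes "finite_set E S" "\<not> a \<^bold>\<in> S"
  shows "\<not> ins a S \<^bold>\<preceq> S"
proof -
  have "\<forall>a. \<not> a \<^bold>\<in> S \<longrightarrow> \<not> ins a S \<^bold>\<preceq> S"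
    using assms(1)
  proof (induction rule: finite_induct)
    case definable show ?case by (intro definability)
  next
    case empty
    show ?case by (auto simp: covered_by_def)
  next
    case (ins S c)
    show ?case
    proof (intro allI impI notI)
      fix a assume a: "\<not> a \<^bold>\<in> ins c S" and cov: "ins a (ins c S) \<^bold>\<preceq> ins c S"
      obtain g where g: "defun g" "\<And>t. t \<^bold>\<in> ins a (ins c S) \<Longrightarrow> \<exists>s. s \<^bold>\<in> ins c S \<and> t = g s"
        using cov by (rule covered_byE) blast
      \<comment> \<open>The value of \<open>g\<close> at \<open>c\<close> is moved to a preimage of \<open>a\<close>, so that \<open>c\<close> can be removed.\<close>
      let ?h = "\<lambda>x. if g x = a then g c else g x"
      have "\<exists>s. s \<^bold>\<in> S \<and> t = ?h s" if t: "t \<^bold>\<in> ins c S" for t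
      proof (cases "t = g c")
        case True
        obtain s where "s \<^bold>\<in> ins c S" "a = g s" using g(2)[of a] by auto
        then show ?thesis using True t a by (intro exI[of _ s]) auto
      next
        case False
        obtain s where "s \<^bold>\<in> ins c S" "t = g s" using g(2)[of t] t by auto
        then show ?thesis using False t a by (intro exI[of _ s]) auto
      qed
      moreover have "defun ?h" by (intro definability defterm_subst1[OF g(1)])
      ultimately have "ins c S \<^bold>\<preceq> S" by (intro covered_byI)
      then show False using ins by blast
    qed
  qed
  then show ?thesis using assms(2) by blast
qed


section \<open>The order of the natural numbers\<close>

lemma omega_trans:
  assumes "n \<^bold>\<in> omega E" "m \<^bold>\<in> n"
  shows "m \<^bold>\<in> omega E" "m \<^bold>\<subseteq> n"
proof -
  have "\<forall>m. m \<^bold>\<in> n \<longrightarrow> m \<^bold>\<in> omega E \<and> m \<^bold>\<subseteq> n"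
    using assms(1) by (rule omega_induct) (intro definability, auto simp: subset_def)
  then show "m \<^bold>\<in> omega E" "m \<^bold>\<subseteq> n" using assms(2) by auto
qed

lemma omega_linear:
  assumes "m \<^bold>\<in> omega E" "n \<^bold>\<in> omega E"
  shows "m \<^bold>\<in> n \<or> m = n \<or> n \<^bold>\<in> m"
proof -
  have zero: "m = empty_set E \<or> empty_set E \<^bold>\<in> m" if "m \<^bold>\<in> omega E" for m
    using that by (rule omega_induct) (intro definability, auto)
  have succ: "succ E n = m \<or> succ E n \<^bold>\<in> m" if "m \<^bold>\<in> omega E" "n \<^bold>\<in> m" for m n
  proof -
    have "\<forall>n. n \<^bold>\<in> m \<longrightarrow> succ E n = m \<or> succ E n \<^bold>\<in> m"
      using that(1) by (rule omega_induct) (intro definability, auto)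
    then show ?thesis using that(2) by blast
  qed
  have "\<forall>m. m \<^bold>\<in> omega E \<longrightarrow> m \<^bold>\<in> n \<or> m = n \<or> n \<^bold>\<in> m"
    using assms(2)
  proof (rule omega_induct)
    show "defpred (\<lambda>e. \<forall>m. m \<^bold>\<in> omega E \<longrightarrow> m \<^bold>\<in> e 0 \<or> m = e 0 \<or> e 0 \<^bold>\<in> m)" by (intro definability)
  qed (use zero succ in auto)
  then show ?thesis using assms(1) by blast
qed

lemma ex_omega_above:
  assumes "m \<^bold>\<in> omega E" "n \<^bold>\<in> omega E"
  obtains b where "b \<^bold>\<in> omega E" "m \<^bold>\<in> b" "n \<^bold>\<in> b"
  using omega_linear[OF assms] assms that[of "succ E m"] that[of "succ E n"] by auto


section \<open>Finite subsets of infinite sets\<close>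

definition diff :: "'a \<Rightarrow> 'a \<Rightarrow> 'a" where
  "diff A B = sep A (\<lambda>x. \<not> x \<^bold>\<in> B)"

lemma mem_diff [simp]: "x \<^bold>\<in> diff A B \<longleftrightarrow> x \<^bold>\<in> A \<and> \<not> x \<^bold>\<in> B"
  unfolding diff_def by (rule mem_sep) (intro definability)

lemma defterm_diff [definability]: "defterm t \<Longrightarrow> defterm u \<Longrightarrow> defterm (\<lambda>e. diff (t e) (u e))"
  by (rule defterm_subst2[where f = diff]) (unfold diff_def, intro definability)

lemma infinite_diff:
  assumes "\<not> finite_set E A" "finite_set E B"
  shows "\<not> finite_set E (diff A B)"
proof
  assume "finite_set E (diff A B)"
  then have "finite_set E (diff A B \<^bold>\<union> B)" using assms(2) by simp
  moreover have "A \<^bold>\<subseteq> diff A B \<^bold>\<union> B" by (simp add: subset_def)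
  ultimately show False using assms(1) finite_subset by blast
qed

lemma infinite_ex_mem: "\<not> finite_set E A \<Longrightarrow> \<exists>x. x \<^bold>\<in> A"
  using eq_empty_iff finite_empty by metis

text \<open>
  The induction extends an embedding by one point at a time, and each single extension exists because
  a finite image does not exhaust \<open>A\<close>; this is why no choice is involved.
\<close>

lemma infinite_embeds_finite:
  assumes "finite_set E S" "\<not> finite_set E A"
  obtains f where "\<And>x. x \<^bold>\<in> S \<Longrightarrow> app f x \<^bold>\<in> A" "inj_on (app f) (elts S)"
proof -
  have "\<exists>f. (\<forall>x. x \<^bold>\<in> S \<longrightarrow> app f x \<^bold>\<in> A) \<and> (\<forall>x y. x \<^bold>\<in> S \<and> y \<^bold>\<in> S \<and> app f x = app f y \<longrightarrow> x = y)"
    using assms(1)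
  proof (induction rule: finite_induct)
    case definable show ?case by (intro definability)
  next
    case empty show ?case by simp
  next
    case (ins S a)
    then obtain f where f: "\<And>x. x \<^bold>\<in> S \<Longrightarrow> app f x \<^bold>\<in> A"
        "\<And>x y. x \<^bold>\<in> S \<Longrightarrow> y \<^bold>\<in> S \<Longrightarrow> app f x = app f y \<Longrightarrow> x = y" by blast
    obtain v where v: "v \<^bold>\<in> A" "\<And>x. x \<^bold>\<in> S \<Longrightarrow> v \<noteq> app f x"
      using infinite_ex_mem[OF infinite_diff[OF assms(2) finite_image_set[OF ins(1) defun_app[of f]]]]
      by (auto simp: mem_image_set[OF defun_app])
    let ?g = "\<lambda>x. if x = a then v else app f x"
    have "defun ?g" by (intro definability)
    note g = app_graph[OF this, of _ "ins a S"]
    show ?case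
    proof (intro exI[of _ "graph ?g (ins a S)"] conjI allI impI)
      show "app (graph ?g (ins a S)) x \<^bold>\<in> A" if "x \<^bold>\<in> ins a S" for x
        using g[OF that] f(1) v(1) that by auto
      fix x y assume xy: "x \<^bold>\<in> ins a S \<and> y \<^bold>\<in> ins a S \<and> app (graph ?g (ins a S)) x = app (graph ?g (ins a S)) y"
      then have "?g x = ?g y" using g[of x] g[of y] by simp
      then show "x = y"
        using xy f(2)[of x y] v(2)[of x] v(2)[of y] by (cases "x = a"; cases "y = a") auto
    qed
  qed
  then show thesis using that by (metis inj_onI mem_Collect_eq)
qed


section \<open>Size classes\<close>

text \<open>
  Order the pairs \<open>(c, j)\<close> with \<open>j < c\<close> lexicographically, and let each of them own the \<open>c + 2\<close> tags
  \<open>((c, j), l)\<close>. Then \<open>tags b i\<close> is the set of the tags owned by the pairs below \<open>(b, i)\<close>. It is finite and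
  grows with the pair, and the pair next to \<open>(b, i)\<close> has the set \<open>tags b (i + 1)\<close>, also when
  \<open>i + 1 = b\<close>.
\<close>

definition tags :: "'a \<Rightarrow> 'a \<Rightarrow> 'a" where
  "tags b i = sep (prod (prod (succ E b) (succ E b)) (succ E (succ E b)))
     (\<lambda>t. \<exists>c j l. t = opair E (opair E c j) l \<and> j \<^bold>\<in> c \<and> l \<^bold>\<in> succ E (succ E c) \<and> (c \<^bold>\<in> b \<or> c = b \<and> j \<^bold>\<in> i))"

text \<open>
  The size of \<open>u\<close> lies between \<open>2\<close> to the power \<open>tags b i\<close>, included, and \<open>2\<close> to the power
  \<open>tags b (i + 1)\<close>, excluded.
\<close>

definition sized :: "'a \<Rightarrow> 'a \<Rightarrow> 'a \<Rightarrow> bool" where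
  "sized b i u \<longleftrightarrow> pow (tags b i) \<^bold>\<preceq> u \<and> \<not> pow (tags b (succ E i)) \<^bold>\<preceq> u"

lemma defterm_tags [definability]: "defterm t \<Longrightarrow> defterm u \<Longrightarrow> defterm (\<lambda>e. tags (t e) (u e))"
  by (rule defterm_subst2[where f = tags]) (unfold tags_def, intro definability)

lemma defpred_sized [definability]:
  "defterm t \<Longrightarrow> defterm u \<Longrightarrow> defterm v \<Longrightarrow> defpred (\<lambda>e. sized (t e) (u e) (v e))"
  unfolding sized_def by (intro definability)

lemma succ_mem_succ:
  assumes "b \<^bold>\<in> omega E" "c \<^bold>\<in> b"
  shows "succ E c \<^bold>\<in> succ E b"
proof -
  have "\<not> b \<^bold>\<in> succ E c" using omega_trans[OF assms] assms(2) by (auto dest: subsetD)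
  then show ?thesis using omega_linear[of "succ E c" b] omega_trans[OF assms] assms by auto
qed

lemma mem_tags:
  assumes b: "b \<^bold>\<in> omega E"
  shows "t \<^bold>\<in> tags b i \<longleftrightarrow>
    (\<exists>c j l. t = opair E (opair E c j) l \<and> j \<^bold>\<in> c \<and> l \<^bold>\<in> succ E (succ E c) \<and> (c \<^bold>\<in> b \<or> c = b \<and> j \<^bold>\<in> i))"
    (is "_ \<longleftrightarrow> ?P t")
proof -
  have "t \<^bold>\<in> tags b i \<longleftrightarrow> t \<^bold>\<in> prod (prod (succ E b) (succ E b)) (succ E (succ E b)) \<and> ?P t"
    unfolding tags_def by (rule mem_sep) (intro definability)
  moreover have "t \<^bold>\<in> prod (prod (succ E b) (succ E b)) (succ E (succ E b))" if "?P t"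
  proof -
    obtain c j l where t: "t = opair E (opair E c j) l" "j \<^bold>\<in> c" "l \<^bold>\<in> succ E (succ E c)" "c \<^bold>\<in> succ E b"
      using \<open>?P t\<close> by auto
    have c: "c \<^bold>\<subseteq> b" using t(4) omega_trans[OF b] by auto
    have "l \<^bold>\<in> succ E (succ E b)" using t(3,4) c succ_mem_succ[OF b] by (auto dest: subsetD)
    moreover have "j \<^bold>\<in> succ E b" using t(2) c by (auto dest: subsetD)
    ultimately show ?thesis unfolding t(1) using t(4) by simp
  qed
  ultimately show ?thesis by blast
qed

lemma finite_tags:
  assumes "b \<^bold>\<in> omega E"
  shows "finite_set E (tags b i)"
proof (rule finite_subset)
  show "finite_set E (prod (prod (succ E b) (succ E b)) (succ E (succ E b)))"
    using assms by (intro finite_prod finite_omega succ_omega)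
  show "tags b i \<^bold>\<subseteq> prod (prod (succ E b) (succ E b)) (succ E (succ E b))"
    unfolding tags_def by (rule subsetI, subst (asm) mem_sep) (intro definability, simp)
qed

lemma tags_mono:
  assumes "b \<^bold>\<in> omega E" "c \<^bold>\<in> omega E" "j \<^bold>\<in> omega E" "b \<^bold>\<in> c \<or> b = c \<and> i \<^bold>\<in> j"
  shows "tags b (succ E i) \<^bold>\<subseteq> tags c j"
proof (rule subsetI)
  fix t assume "t \<^bold>\<in> tags b (succ E i)"
  then obtain c' j' l where t: "t = opair E (opair E c' j') l" "j' \<^bold>\<in> c'" "l \<^bold>\<in> succ E (succ E c')"
      "c' \<^bold>\<in> b \<or> c' = b \<and> j' \<^bold>\<in> succ E i"
    unfolding mem_tags[OF assms(1)] by blast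
  have "c' \<^bold>\<in> c \<or> c' = c \<and> j' \<^bold>\<in> j"
    using t(4) assms(4) omega_trans[OF assms(2), of b] omega_trans[OF assms(3), of i] by (auto dest: subsetD)
  then show "t \<^bold>\<in> tags c j" unfolding mem_tags[OF assms(2)] using t(1-3) by blast
qed

text \<open>
  Of two different pairs the smaller one has its upper bound below the lower bound of the other one.
\<close>

lemma sized_unique:
  assumes "b \<^bold>\<in> omega E" "i \<^bold>\<in> b" "sized b i u" and "c \<^bold>\<in> omega E" "j \<^bold>\<in> c" "sized c j u"
  shows "b = c \<and> i = j"
proof -
  have less: False if "b \<^bold>\<in> omega E" "c \<^bold>\<in> omega E" "j \<^bold>\<in> c" "b \<^bold>\<in> c \<or> b = c \<and> i \<^bold>\<in> j" "sized b i u" "sized c j u"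
    for b c i j
  proof -
    have "tags b (succ E i) \<^bold>\<subseteq> tags c j"
      using that omega_trans[of c j] by (intro tags_mono) auto
    then have "pow (tags b (succ E i)) \<^bold>\<preceq> pow (tags c j)"
      by (intro covered_by_subset subsetI) (auto intro: subset_trans)
    then show False using that(5,6) covered_by_trans unfolding sized_def by blast
  qed
  have "i \<^bold>\<in> omega E" "j \<^bold>\<in> omega E" using assms omega_trans by blast+
  then show ?thesis
    using less[of b c j i] less[of c b i j] assms omega_linear[of b c] omega_linear[of i j] by blast
qed

lemma finite_covered_by:
  assumes "finite_set E S" "T \<^bold>\<preceq> S"
  shows "finite_set E T"
proof -
  obtain g where "defun g" "\<And>t. t \<^bold>\<in> T \<Longrightarrow> \<exists>s. s \<^bold>\<in> S \<and> t = g s" using assms(2) by (rule covered_byE) blast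
  then show ?thesis by (intro finite_surj[OF assms(1)]) auto
qed

text \<open>
  The reason for the \<open>b + 2\<close> new tags: the upper end of a class exceeds \<open>b + 1\<close> times its lower end
  by more than \<open>b\<close>. The proof covers a set with one element more than \<open>x \<union> z\<close> by the subsets of
  \<open>tags b (i + 1)\<close>. A subset \<open>s\<close> of the old tags together with one new tag \<open>l \<le> b\<close> codes the pair \<open>(s, l)\<close>. The sets of two new tags
  that consist of the last tag \<open>b + 1\<close> and another one remain; they cover \<open>x\<close> and the additional element.
\<close>

lemma next_size_not_covered:
  assumes b: "b \<^bold>\<in> omega E" and i: "i \<^bold>\<in> b" and m: "m \<^bold>\<in> b"
    and x: "x \<^bold>\<preceq> m" and z: "z \<^bold>\<preceq> prod (pow (tags b i)) (succ E b)"
  shows "\<not> pow (tags b (succ E i)) \<^bold>\<preceq> x \<^bold>\<union> z"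
proof
  let ?y = "x \<^bold>\<union> z"
  define tag where "tag l = opair E (opair E b i) l" for l
  have tag_def': "defterm t \<Longrightarrow> defterm (\<lambda>e. tag (t e))" for t
    unfolding tag_def by (intro definability)
  have tag_inj [simp]: "tag k = tag l \<longleftrightarrow> k = l" for k l by (simp add: tag_def)
  have old: "\<not> tag l \<^bold>\<in> tags b i" for l unfolding tag_def mem_tags[OF b] by auto
  have new: "tag l \<^bold>\<in> tags b (succ E i)" if "l \<^bold>\<in> succ E (succ E b)" for l
    unfolding tag_def mem_tags[OF b] using i that by auto
  have mono: "tags b i \<^bold>\<subseteq> tags b (succ E i)"
    by (rule subsetI) (auto simp: mem_tags[OF b])
  \<comment> \<open>The additional element is \<open>x \<union> z\<close> itself, which is not in \<open>x \<union> z\<close>.\<close>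
  obtain f where f: "defun f" "\<And>t. t \<^bold>\<in> x \<Longrightarrow> \<exists>s. s \<^bold>\<in> m \<and> t = f s" using x by (rule covered_byE) blast
  obtain h where h: "defun h" "\<And>t. t \<^bold>\<in> z \<Longrightarrow> \<exists>s. s \<^bold>\<in> prod (pow (tags b i)) (succ E b) \<and> t = h s"
    using z by (rule covered_byE) blast
  have finite: "finite_set E ?y"
    using finite_covered_by[OF _ x] finite_covered_by[OF _ z] finite_omega finite_prod finite_pow finite_tags
      omega_trans[OF b m] b by simp
  define g where "g v = (if tag (succ E b) \<^bold>\<in> v
     then (if tag m \<^bold>\<in> v then ?y else f (the_set (\<lambda>k. tag k \<^bold>\<in> v \<and> k \<noteq> succ E b)))
     else h (opair E (sep v (\<lambda>w. w \<^bold>\<in> tags b i)) (the_set (\<lambda>l. tag l \<^bold>\<in> v))))" for v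
  have g: "defun g"
    unfolding g_def by (intro definability tag_def' defterm_subst1[OF f(1)] defterm_subst1[OF h(1)])
  have neq: "k \<noteq> succ E b" if "k \<^bold>\<in> succ E b" for k using that mem_irrefl by metis
  have m_sub: "m \<^bold>\<subseteq> b" using omega_trans[OF b m] by simp
  have "\<exists>v. v \<^bold>\<in> pow (tags b (succ E i)) \<and> t = g v" if "t \<^bold>\<in> ins ?y ?y" for t
  proof -
    consider "t = ?y" | "t \<^bold>\<in> x" | "t \<^bold>\<in> z" using \<open>t \<^bold>\<in> ins ?y ?y\<close> by auto
    then show ?thesis
    proof cases
      case 1
      show ?thesis
        by (rule exI[of _ "upair E (tag m) (tag (succ E b))"]) (use 1 m in \<open>auto simp: g_def subset_def new\<close>)
    next
      case 2
      then obtain k where k: "k \<^bold>\<in> m" "t = f k" using f(2) by blast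
      have "k \<^bold>\<in> b" using k(1) m_sub by (rule subsetD[rotated])
      let ?v = "upair E (tag k) (tag (succ E b))"
      have "the_set (\<lambda>k. tag k \<^bold>\<in> ?v \<and> k \<noteq> succ E b) = k"
        by (rule the_set_eq) (use neq[of k] \<open>k \<^bold>\<in> b\<close> in auto)
      moreover have "\<not> tag m \<^bold>\<in> ?v" using k(1) neq[of m] m by auto
      ultimately have "t = g ?v" using k(2) unfolding g_def by simp
      moreover have "?v \<^bold>\<in> pow (tags b (succ E i))" using \<open>k \<^bold>\<in> b\<close> by (auto simp: subset_def new)
      ultimately show ?thesis by blast
    next
      case 3
      then obtain p where p: "p \<^bold>\<in> prod (pow (tags b i)) (succ E b)" "t = h p" using h(2) by blast
      then obtain s l where s: "s \<^bold>\<subseteq> tags b i" "l \<^bold>\<in> succ E b" "t = h (opair E s l)"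
        unfolding mem_prod mem_pow by blast
      let ?v = "ins (tag l) s"
      have tag: "tag k \<^bold>\<in> ?v \<longleftrightarrow> k = l" for k using s(1) old by (auto dest: subsetD)
      have "the_set (\<lambda>k. tag k \<^bold>\<in> ?v) = l" by (rule the_set_eq) (simp_all only: tag)
      moreover have "sep ?v (\<lambda>w. w \<^bold>\<in> tags b i) = s"
        by (rule eqI, subst mem_sep) (intro definability, use s(1) old in \<open>auto dest: subsetD\<close>)
      moreover have "succ E b \<noteq> l" using neq[OF s(2)] by blast
      ultimately have "t = g ?v" using s(3) unfolding g_def tag by simp
      moreover have "?v \<^bold>\<in> pow (tags b (succ E i))"
        using s(1,2) new[of l] mono by (auto simp: subset_def)
      ultimately show ?thesis by blast
    qed
  qed
  then have "ins ?y ?y \<^bold>\<preceq> pow (tags b (succ E i))" using g by (intro covered_byI)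
  moreover assume "pow (tags b (succ E i)) \<^bold>\<preceq> ?y"
  ultimately show False using covered_by_trans pigeonhole[OF finite mem_irrefl] by blast
qed


section \<open>Partitions\<close>

abbreviation "nsb \<equiv> nonsingleton_blocks E"

definition support :: "'a \<Rightarrow> 'a" where
  "support P = bigun (nsb P)"

definition refines :: "'a \<Rightarrow> 'a \<Rightarrow> bool" where
  "refines Q P \<longleftrightarrow> (\<forall>c. c \<^bold>\<in> Q \<longrightarrow> (\<exists>d. d \<^bold>\<in> P \<and> c \<^bold>\<subseteq> d))"

text \<open>
  Used for a non-singleton block \<open>b\<close> and for \<open>z\<close> outside the support of \<open>P\<close>. Then the blocks that meet \<open>z\<close>
  are the singletons of its elements, so that the result is again a partition and has as many non-singleton
  blocks as \<open>P\<close>.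
\<close>

definition enlarge :: "'a \<Rightarrow> 'a \<Rightarrow> 'a \<Rightarrow> 'a" where
  "enlarge P b z = ins (b \<^bold>\<union> z) (sep P (\<lambda>c. c \<noteq> b \<and> \<not> (\<exists>x. x \<^bold>\<in> c \<and> x \<^bold>\<in> z)))"

lemma defterm_nsb [definability]: "defterm t \<Longrightarrow> defterm (\<lambda>e. nsb (t e))"
  by (rule defterm_subst1[where f = nsb])
    (unfold defterm_def ext_iff[of _ "nsb _"] mem_nonsingleton_blocks, intro definability)

lemma defterm_support [definability]: "defterm t \<Longrightarrow> defterm (\<lambda>e. support (t e))"
  unfolding support_def by (intro definability)

lemma defpred_refines [definability]: "defterm t \<Longrightarrow> defterm u \<Longrightarrow> defpred (\<lambda>e. refines (t e) (u e))"
  by (rule defpred_subst2[where R = refines]) (unfold refines_def, intro definability)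

lemma mem_enlarge: "c \<^bold>\<in> enlarge P b z \<longleftrightarrow> c = b \<^bold>\<union> z \<or> c \<^bold>\<in> P \<and> c \<noteq> b \<and> \<not> (\<exists>x. x \<^bold>\<in> c \<and> x \<^bold>\<in> z)"
proof -
  have "c \<^bold>\<in> sep P (\<lambda>c. c \<noteq> b \<and> \<not> (\<exists>x. x \<^bold>\<in> c \<and> x \<^bold>\<in> z)) \<longleftrightarrow> c \<^bold>\<in> P \<and> c \<noteq> b \<and> \<not> (\<exists>x. x \<^bold>\<in> c \<and> x \<^bold>\<in> z)"
    by (rule mem_sep) (intro definability)
  then show ?thesis unfolding enlarge_def by simp
qed

lemma defterm_enlarge [definability]: "defterm t \<Longrightarrow> defterm (\<lambda>e. enlarge P b (t e))"
  by (rule defterm_subst1[where f = "enlarge P b"]) (unfold enlarge_def, intro definability)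

lemma mem_support: "x \<^bold>\<in> support P \<longleftrightarrow> (\<exists>c. c \<^bold>\<in> nsb P \<and> x \<^bold>\<in> c)"
  unfolding support_def by auto

lemma partition_nonempty: "is_partition E P A \<Longrightarrow> c \<^bold>\<in> P \<Longrightarrow> \<exists>x. x \<^bold>\<in> c"
  and partition_mem: "is_partition E P A \<Longrightarrow> c \<^bold>\<in> P \<Longrightarrow> x \<^bold>\<in> c \<Longrightarrow> x \<^bold>\<in> A"
  and partition_cover: "is_partition E P A \<Longrightarrow> x \<^bold>\<in> A \<Longrightarrow> \<exists>c. c \<^bold>\<in> P \<and> x \<^bold>\<in> c"
  and partition_disjoint: "is_partition E P A \<Longrightarrow> c \<^bold>\<in> P \<Longrightarrow> d \<^bold>\<in> P \<Longrightarrow> x \<^bold>\<in> c \<Longrightarrow> x \<^bold>\<in> d \<Longrightarrow> c = d"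
  unfolding is_partition_def by blast+

lemma block_outside_support:
  assumes "c \<^bold>\<in> P" "x \<^bold>\<in> c" "\<not> x \<^bold>\<in> support P"
  shows "c = upair E x x"
proof -
  have "\<not> c \<^bold>\<in> nsb P" using assms unfolding mem_support by blast
  then obtain y where "c = upair E y y" using assms(1) unfolding mem_nonsingleton_blocks by blast
  then show ?thesis using assms(2) by simp
qed

lemma refines_refl [simp]: "refines P P"
  unfolding refines_def using subset_refl by blast

lemma refines_trans: "refines R Q \<Longrightarrow> refines Q P \<Longrightarrow> refines R P"
  unfolding refines_def using subset_trans by meson

lemma refines_antisym:
  assumes "is_partition E P A" "is_partition E Q A" "refines Q P" "refines P Q"
  shows "Q = P"
proof -
  have sub: "c \<^bold>\<in> P" if Q: "is_partition E Q A" "refines Q P" "refines P Q" and c: "c \<^bold>\<in> Q" for P Q c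
  proof -
    obtain d where d: "d \<^bold>\<in> P" "c \<^bold>\<subseteq> d" using Q c unfolding refines_def by blast
    then obtain c' where c': "c' \<^bold>\<in> Q" "d \<^bold>\<subseteq> c'" using Q unfolding refines_def by blast
    obtain x where x: "x \<^bold>\<in> c" using partition_nonempty Q c by blast
    have "c = c'" using partition_disjoint[OF Q(1) c c'(1) x] x d(2) c'(2) subsetD by blast
    then have "c = d" using d(2) c'(2) by (intro eqI) (auto dest: subsetD)
    then show ?thesis using d(1) by simp
  qed
  show ?thesis by (rule eqI) (use sub assms in blast)
qed

lemma support_mono:
  assumes Q: "is_partition E Q A" and "refines Q P"
  shows "support Q \<^bold>\<subseteq> support P"
proof (rule subsetI)
  fix x assume "x \<^bold>\<in> support Q"
  then obtain c where c: "c \<^bold>\<in> Q" "c \<noteq> upair E y y" "x \<^bold>\<in> c" for y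
    unfolding mem_support mem_nonsingleton_blocks by blast
  obtain d where d: "d \<^bold>\<in> P" "c \<^bold>\<subseteq> d" using c(1) assms(2) unfolding refines_def by blast
  have "d \<noteq> upair E y y" for y
  proof
    assume "d = upair E y y"
    then have "c = upair E y y" using d(2) c(3) by (intro eqI) (auto dest: subsetD)
    then show False using c(2) by blast
  qed
  then show "x \<^bold>\<in> support P"
    unfolding mem_support mem_nonsingleton_blocks using d c(3) subsetD by blast
qed

text \<open>
  A partition of \<open>A\<close> is determined by its non-singleton blocks, and those of a refinement of \<open>P\<close> are
  subsets of the finite support of \<open>P\<close>.
\<close>

lemma finite_refinements:
  assumes "finite_set E (support P)" and B: "\<And>Q. Q \<^bold>\<in> B \<Longrightarrow> is_partition E Q A"
  shows "finite_set E (sep B (\<lambda>Q. refines Q P))"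
proof -
  have dR: "defpred (\<lambda>e. refines (e 0) P)" by (intro definability)
  have ds: "defun (\<lambda>x. upair E x x)" by (intro definability)
  define g where "g N = N \<^bold>\<union> image_set (\<lambda>x. upair E x x) (diff A (bigun N))" for N
  have g: "defun g" unfolding g_def by (intro definability)
  have "Q \<in> g ` elts (pow (pow (support P)))" if "Q \<^bold>\<in> sep B (\<lambda>Q. refines Q P)" for Q
  proof
    have Q: "is_partition E Q A" "refines Q P" using that B by (auto simp: mem_sep[OF dR])
    have "c \<^bold>\<subseteq> support P" if "c \<^bold>\<in> nsb Q" for c
      using support_mono[OF Q] that by (auto simp: subset_def mem_support)
    then show "nsb Q \<in> elts (pow (pow (support P)))" by (auto simp: subset_def)
    show "Q = g (nsb Q)"
    proof (rule eqI)
      fix c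
      have "c \<^bold>\<in> Q \<longleftrightarrow> (\<exists>x. x \<^bold>\<in> A \<and> \<not> x \<^bold>\<in> support Q \<and> c = upair E x x)" if nc: "\<not> c \<^bold>\<in> nsb Q"
      proof
        assume c: "c \<^bold>\<in> Q"
        then obtain x where x: "c = upair E x x" using nc unfolding mem_nonsingleton_blocks by blast
        have "x \<^bold>\<in> A" using partition_mem[OF Q(1) c] x by simp
        moreover have "\<not> x \<^bold>\<in> support Q"
        proof
          assume "x \<^bold>\<in> support Q"
          then obtain d where d: "d \<^bold>\<in> nsb Q" "x \<^bold>\<in> d" unfolding mem_support by blast
          then have "c = d" using partition_disjoint[OF Q(1) c, of d x] x by (simp add: mem_nonsingleton_blocks)
          then show False using d(1) nc by simp
        qed
        ultimately show "\<exists>x. x \<^bold>\<in> A \<and> \<not> x \<^bold>\<in> support Q \<and> c = upair E x x" using x by blast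
      next
        assume "\<exists>x. x \<^bold>\<in> A \<and> \<not> x \<^bold>\<in> support Q \<and> c = upair E x x"
        then show "c \<^bold>\<in> Q" using partition_cover[OF Q(1)] block_outside_support by metis
      qed
      moreover have "c \<^bold>\<in> Q" if "c \<^bold>\<in> nsb Q" using that by (simp add: mem_nonsingleton_blocks)
      moreover have "c \<^bold>\<in> g (nsb Q) \<longleftrightarrow> c \<^bold>\<in> nsb Q \<or> (\<exists>x. x \<^bold>\<in> A \<and> \<not> x \<^bold>\<in> support Q \<and> c = upair E x x)"
        unfolding g_def support_def[symmetric] by (auto simp: mem_image_set[OF ds])
      ultimately show "c \<^bold>\<in> Q \<longleftrightarrow> c \<^bold>\<in> g (nsb Q)" by blast
    qed
  qed
  then have "elts (sep B (\<lambda>Q. refines Q P)) \<subseteq> g ` elts (pow (pow (support P)))" by blast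
  then show ?thesis by (rule finite_surj[OF finite_pow[OF finite_pow[OF assms(1)]] g])
qed

lemma equipotent_trans:
  assumes "equipotent E A B" "equipotent E B C"
  shows "equipotent E A C"
proof -
  obtain g where g: "defun g" "bij_betw g (elts A) (elts B)" using assms(1) by (rule equipotentE)
  obtain h where h: "defun h" "bij_betw h (elts B) (elts C)" using assms(2) by (rule equipotentE)
  show ?thesis
    by (rule equipotentI[OF defun_comp[OF h(1) g(1)]]) (use bij_betw_trans[OF g(2) h(2)] in \<open>simp add: comp_def\<close>)
qed

lemma Bn_partition: "P \<^bold>\<in> Bn E n A \<Longrightarrow> is_partition E P A"
  by (simp add: mem_Bn finitary_partition_def)

lemma Bn_finite_support:
  assumes "n \<^bold>\<in> omega E" "P \<^bold>\<in> Bn E n A"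
  shows "finite_set E (support P)"
  unfolding support_def
  by (rule finite_bigun) (use assms in \<open>auto simp: mem_Bn finitary_partition_def mem_nonsingleton_blocks finite_setI\<close>)

context
  fixes n A P b
  assumes P: "P \<^bold>\<in> Bn E n A" and b: "b \<^bold>\<in> nsb P"
begin

lemma b_mem: "b \<^bold>\<in> P" "b \<noteq> upair E x x"
  using b by (auto simp: mem_nonsingleton_blocks)

lemma is_partition_P: "is_partition E P A"
  by (rule Bn_partition[OF P])

lemma enlarge_empty: "enlarge P b (empty_set E) = P"
proof -
  have "b \<^bold>\<union> empty_set E = b" by (rule eqI) simp
  then show ?thesis using b_mem by (intro eqI) (auto simp: mem_enlarge)
qed

context
  fixes z
  assumes z_sub: "z \<^bold>\<subseteq> A" and z_supp: "\<And>x. x \<^bold>\<in> z \<Longrightarrow> \<not> x \<^bold>\<in> support P"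
begin

lemma is_partition_enlarge: "is_partition E (enlarge P b z) A"
  unfolding is_partition_def
proof (intro conjI allI impI)
  note p = is_partition_P
  fix c assume c: "c \<^bold>\<in> enlarge P b z"
  show "\<exists>x. x \<^bold>\<in> c" using c partition_nonempty[OF p, of b] partition_nonempty[OF p, of c] b_mem(1) by (auto simp: mem_enlarge)
  show "x \<^bold>\<in> A" if "x \<^bold>\<in> c" for x
    using c that partition_mem[OF p, of _ x] b_mem(1) z_sub by (auto simp: mem_enlarge dest: subsetD)
  fix d assume d: "d \<^bold>\<in> enlarge P b z" and "c \<noteq> d"
  then show "\<not> (\<exists>x. x \<^bold>\<in> c \<and> x \<^bold>\<in> d)"
    using c partition_disjoint[OF p, of c d] partition_disjoint[OF p, of b d] partition_disjoint[OF p, of c b] b_mem(1)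
    by (auto simp: mem_enlarge)
next
  fix x assume x: "x \<^bold>\<in> A"
  obtain c where c: "c \<^bold>\<in> P" "x \<^bold>\<in> c" using partition_cover[OF is_partition_P x] by blast
  show "\<exists>c. c \<^bold>\<in> enlarge P b z \<and> x \<^bold>\<in> c"
  proof (cases "x \<^bold>\<in> z \<or> x \<^bold>\<in> b")
    case True
    then show ?thesis by (intro exI[of _ "b \<^bold>\<union> z"]) (auto simp: mem_enlarge)
  next
    case False
    have "\<not> y \<^bold>\<in> z" if y: "y \<^bold>\<in> c" for y
    proof
      assume "y \<^bold>\<in> z"
      then have "c = upair E y y" using block_outside_support[OF c(1) y z_supp] by simp
      then show False using c(2) False \<open>y \<^bold>\<in> z\<close> by simp
    qed
    then show ?thesis using c False by (intro exI[of _ c]) (auto simp: mem_enlarge)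
  qed
qed

lemma nsb_enlarge: "nsb (enlarge P b z) = ins (b \<^bold>\<union> z) (remove b (nsb P))"
proof (rule eqI)
  fix c
  have "b \<^bold>\<union> z \<noteq> upair E y y" for y
  proof
    assume *: "b \<^bold>\<union> z = upair E y y"
    then have sub: "x = y" if "x \<^bold>\<in> b" for x using that mem_un mem_upair by metis
    obtain x where "x \<^bold>\<in> b" using partition_nonempty[OF is_partition_P] b_mem by blast
    then have "b = upair E y y" using sub by (intro eqI) auto
    then show False using b_mem by blast
  qed
  moreover have "\<not> (\<exists>x. x \<^bold>\<in> c \<and> x \<^bold>\<in> z)" if "c \<^bold>\<in> nsb P"
    using that z_supp unfolding mem_support by blast
  ultimately show "c \<^bold>\<in> nsb (enlarge P b z) \<longleftrightarrow> c \<^bold>\<in> ins (b \<^bold>\<union> z) (remove b (nsb P))"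
    by (auto simp: mem_enlarge mem_nonsingleton_blocks)
qed

lemma support_enlarge: "support (enlarge P b z) = support P \<^bold>\<union> z"
proof (rule eqI)
  fix x
  have "x \<^bold>\<in> support (enlarge P b z) \<longleftrightarrow> x \<^bold>\<in> b \<^bold>\<union> z \<or> (\<exists>c. c \<^bold>\<in> nsb P \<and> c \<noteq> b \<and> x \<^bold>\<in> c)"
    unfolding mem_support nsb_enlarge mem_ins mem_remove by blast
  then show "x \<^bold>\<in> support (enlarge P b z) \<longleftrightarrow> x \<^bold>\<in> support P \<^bold>\<union> z"
    unfolding mem_un mem_support using b by blast
qed

lemma enlarge_Bn:
  assumes "finite_set E z"
  shows "enlarge P b z \<^bold>\<in> Bn E n A"
  unfolding mem_Bn finitary_partition_def
proof (intro conjI allI impI)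
  show "is_partition E (enlarge P b z) A" by (rule is_partition_enlarge)
  show "finite_set E c" if "c \<^bold>\<in> enlarge P b z" for c
    using that P b_mem assms by (auto simp: mem_enlarge mem_Bn finitary_partition_def)
  let ?g = "\<lambda>c. if c = b \<^bold>\<union> z then b else c"
  have notin: "\<not> b \<^bold>\<union> z \<^bold>\<in> remove b (nsb P)"
  proof
    assume "b \<^bold>\<union> z \<^bold>\<in> remove b (nsb P)"
    then have "b \<^bold>\<union> z \<^bold>\<in> P" "b \<^bold>\<union> z \<noteq> b" by (auto simp: mem_nonsingleton_blocks)
    moreover obtain x where "x \<^bold>\<in> b" using partition_nonempty[OF is_partition_P] b_mem by blast
    ultimately show False using partition_disjoint[OF is_partition_P _ b_mem(1), of "b \<^bold>\<union> z" x] by simp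
  qed
  have "bij_betw ?g (elts (nsb (enlarge P b z))) (elts (nsb P))"
  proof (rule bij_betw_imageI)
    show "inj_on ?g (elts (nsb (enlarge P b z)))"
      using notin unfolding nsb_enlarge by (intro inj_onI) (auto split: if_splits)
    show "?g ` elts (nsb (enlarge P b z)) = elts (nsb P)"
      using notin b unfolding nsb_enlarge by (auto simp: image_iff split: if_splits)
  qed
  then have "equipotent E (nsb (enlarge P b z)) (nsb P)"
    by (rule equipotentI[rotated]) (intro definability)
  then show "equipotent E (nsb (enlarge P b z)) n"
    by (rule equipotent_trans) (use P in \<open>simp add: mem_Bn\<close>)
qed

lemma refines_enlarge_mono:
  assumes "w \<^bold>\<subseteq> z" "refines Q (enlarge P b w)"
  shows "refines Q (enlarge P b z)"
proof (rule refines_trans[OF assms(2)], unfold refines_def, intro allI impI)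
  fix d assume d: "d \<^bold>\<in> enlarge P b w"
  show "\<exists>d'. d' \<^bold>\<in> enlarge P b z \<and> d \<^bold>\<subseteq> d'"
  proof (cases "d = b \<^bold>\<union> w \<or> (\<exists>x. x \<^bold>\<in> d \<and> x \<^bold>\<in> z)")
    case True
    have "y \<^bold>\<in> b \<^bold>\<union> z" if y: "y \<^bold>\<in> d" for y
    proof (cases "d = b \<^bold>\<union> w")
      case True
      then show ?thesis using y assms(1) by (auto dest: subsetD)
    next
      case False
      then obtain x where "x \<^bold>\<in> d" "x \<^bold>\<in> z" "d \<^bold>\<in> P" using \<open>_ \<or> _\<close> d by (auto simp: mem_enlarge)
      then have "d = upair E x x" using block_outside_support z_supp by blast
      then show ?thesis using y \<open>x \<^bold>\<in> z\<close> by simp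
    qed
    then show ?thesis by (intro exI[of _ "b \<^bold>\<union> z"]) (simp add: mem_enlarge subset_def)
  next
    case False
    then show ?thesis using d by (intro exI[of _ d]) (simp add: mem_enlarge)
  qed
qed

end

text \<open>
  A point in \<open>z\<close> but not in \<open>w\<close> is a singleton block of \<open>Q\<close>, hence refinement does not notice its removal from
  the enlarged block. In the inclusion and exclusion argument, this separates the
  partitions that use a given set of new points from those that do not.
\<close>

lemma refines_enlarge_shrink:
  assumes w: "w \<^bold>\<subseteq> A" "\<And>x. x \<^bold>\<in> w \<Longrightarrow> \<not> x \<^bold>\<in> support P" and "w \<^bold>\<subseteq> z"
    and Q: "is_partition E Q A" "refines Q (enlarge P b z)"
    and disj: "\<And>x. x \<^bold>\<in> z \<Longrightarrow> \<not> x \<^bold>\<in> w \<Longrightarrow> \<not> x \<^bold>\<in> support Q"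
  shows "refines Q (enlarge P b w)"
  unfolding refines_def
proof (intro allI impI)
  fix c assume c: "c \<^bold>\<in> Q"
  then obtain d where d: "d \<^bold>\<in> enlarge P b z" "c \<^bold>\<subseteq> d" using Q(2) unfolding refines_def by blast
  show "\<exists>d. d \<^bold>\<in> enlarge P b w \<and> c \<^bold>\<subseteq> d"
  proof (cases "d = b \<^bold>\<union> z")
    case False
    then show ?thesis using d \<open>w \<^bold>\<subseteq> z\<close> by (intro exI[of _ d]) (auto simp: mem_enlarge dest: subsetD)
  next
    case True
    show ?thesis
    proof (cases "\<exists>x. x \<^bold>\<in> c \<and> x \<^bold>\<in> z \<and> \<not> x \<^bold>\<in> w")
      case False
      then have "c \<^bold>\<subseteq> b \<^bold>\<union> w" using d(2) \<open>d = b \<^bold>\<union> z\<close> by (auto simp: subset_def)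
      then show ?thesis by (intro exI[of _ "b \<^bold>\<union> w"]) (simp add: mem_enlarge)
    next
      case True
      then obtain x where x: "x \<^bold>\<in> c" "x \<^bold>\<in> z" "\<not> x \<^bold>\<in> w" by blast
      then have ceq: "c = upair E x x" using block_outside_support[OF c] disj by blast
      have "x \<^bold>\<in> A" using partition_mem[OF Q(1) c x(1)] .
      then obtain d' where "d' \<^bold>\<in> enlarge P b w" "x \<^bold>\<in> d'"
        using partition_cover[OF is_partition_enlarge[OF w]] by blast
      then show ?thesis using ceq by (intro exI[of _ d']) (simp add: subset_def)
    qed
  qed
qed

end


section \<open>Recovering a set of partitions from parities\<close>

text \<open>
  Inclusion and exclusion over the sets of indices \<open>W\<close>, as an induction. Let \<open>J\<close> be a set of indices disjoint from
  \<open>W\<close>, and count modulo 2 the members of \<open>D\<close> of support size at most \<open>b\<close> that refine the enlargement of \<open>P\<close>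
  by the groups of \<open>W \<union> J\<close> and meet all groups of \<open>J\<close>. The number is even unless \<open>W\<close> is empty, and for empty
  \<open>W\<close> it has the same parity for all \<open>J\<close>. Indeed, to add an index \<open>a\<close> to \<open>J\<close>, subtract from the number
  for \<open>W \<union> {a}\<close> and \<open>J\<close>, which is even, the number for \<open>W\<close> and \<open>J\<close>: the partitions that do not
  meet the group of \<open>a\<close> cancel. For empty \<open>W\<close> and \<open>J\<close> only \<open>P\<close> is counted, and for empty \<open>W\<close> and all indices in \<open>J\<close>
  nothing is counted, as the support of the partition would be mapped onto the \<open>b + 1\<close> indices.
\<close>

lemma parities_determine:
  assumes A: "\<not> finite_set E A" and n: "n \<^bold>\<in> omega E" "n \<noteq> empty_set E" and i: "i \<^bold>\<in> omega E"
    and D: "D \<^bold>\<subseteq> Bn E n A"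
    and even: "\<And>b y. b \<^bold>\<in> omega E \<Longrightarrow> i \<^bold>\<in> b \<Longrightarrow> y \<^bold>\<in> Bn E n A \<Longrightarrow> sized b i (support y) \<Longrightarrow>
      \<not> odd_set (sep D (\<lambda>Q. refines Q y \<and> \<not> succ E b \<^bold>\<preceq> support Q))"
  shows "\<not> Q0 \<^bold>\<in> D"
proof
  assume Q0: "Q0 \<^bold>\<in> D"
  have part: "is_partition E Q A" if "Q \<^bold>\<in> D" for Q
    using that D Bn_partition subsetD by blast
  have fin_supp: "finite_set E (support Q)" if "Q \<^bold>\<in> D" for Q
    using that D Bn_finite_support n(1) subsetD by blast
  have mem_ref: "Q \<^bold>\<in> sep D (\<lambda>Q. refines Q y) \<longleftrightarrow> Q \<^bold>\<in> D \<and> refines Q y" for Q y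
    by (rule mem_sep) (intro definability)
  obtain P where P: "P \<^bold>\<in> D" and minimal: "\<And>Q. Q \<^bold>\<in> D \<Longrightarrow> refines Q P \<Longrightarrow> Q = P"
  proof (rule finite_minimal[where R = refines, OF finite_refinements[OF fin_supp[OF Q0] part]])
    show "Q0 \<^bold>\<in> sep D (\<lambda>Q. refines Q Q0)" using Q0 by (simp add: mem_ref)
    show "defpred (\<lambda>e. refines (e 0) (e (Suc 0)))" by (intro definability)
    show "Q = R" if "Q \<^bold>\<in> sep D (\<lambda>Q. refines Q Q0)" "R \<^bold>\<in> sep D (\<lambda>Q. refines Q Q0)" "refines Q R" "refines R Q" for Q R
      using that refines_antisym[OF part[of R] part[of Q]] by (simp add: mem_ref)
    fix m assume m: "m \<^bold>\<in> sep D (\<lambda>Q. refines Q Q0)" "\<And>Q. Q \<^bold>\<in> sep D (\<lambda>Q. refines Q Q0) \<Longrightarrow> refines Q m \<Longrightarrow> Q = m"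
    show thesis by (rule that[of m]) (use m refines_trans in \<open>auto simp: mem_ref\<close>)
  qed (auto intro: refines_trans)
  have PB: "P \<^bold>\<in> Bn E n A" using P D subsetD by blast
  obtain c where c: "c \<^bold>\<in> nsb P"
  proof -
    obtain g where g: "bij_betw g (elts (nsb P)) (elts n)"
      using PB unfolding mem_Bn by (blast elim: equipotentE)
    obtain k where "k \<^bold>\<in> n" using n(2) eq_empty_iff by blast
    then have "k \<in> g ` elts (nsb P)" using g by (simp add: bij_betw_def)
    then show thesis using that by blast
  qed
  obtain m where m: "m \<^bold>\<in> omega E" "equipotent E (support P) m" using fin_supp[OF P] by (rule finite_setE)
  obtain b where b: "b \<^bold>\<in> omega E" "m \<^bold>\<in> b" "i \<^bold>\<in> b" using ex_omega_above[OF m(1) i] by blast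
  obtain g where g: "defun g" "bij_betw g (elts (support P)) (elts m)" using m(2) by (rule equipotentE)
  have supp_m: "support P \<^bold>\<preceq> m"
    by (rule covered_by_inj[OF g(1) bij_betw_imp_inj_on[OF g(2)]]) (use bij_betwE[OF g(2)] in auto)
  have small_P: "\<not> succ E b \<^bold>\<preceq> support P"
  proof
    assume "succ E b \<^bold>\<preceq> support P"
    then have "succ E b \<^bold>\<preceq> m" using supp_m by (rule covered_by_trans)
    moreover have "ins m m \<^bold>\<subseteq> succ E b" using b(2) omega_trans[OF b(1,2)] by (auto simp: subset_def)
    ultimately have "ins m m \<^bold>\<preceq> m" using covered_by_trans covered_by_subset by blast
    then show False using pigeonhole[OF finite_omega[OF m(1)]] by simp
  qed
  let ?C = "pow (tags b i)"
  have fin_C: "finite_set E (prod ?C (succ E b))"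
    by (intro finite_prod finite_pow finite_tags finite_omega succ_omega b(1))
  obtain f where f: "\<And>p. p \<^bold>\<in> prod ?C (succ E b) \<Longrightarrow> app f p \<^bold>\<in> diff A (support P)"
      "inj_on (app f) (elts (prod ?C (succ E b)))"
    using infinite_embeds_finite[OF fin_C infinite_diff[OF A fin_supp[OF P]]] by blast
  \<comment> \<open>The group of points with index \<open>l\<close> is the image of \<open>?C \<times> {l}\<close>, and \<open>z W\<close> is the union of the groups of \<open>W\<close>.\<close>
  define z where "z W = image_set (app f) (prod ?C W)" for W
  have dz [definability]: "defterm t \<Longrightarrow> defterm (\<lambda>e. z (t e))" for t
    unfolding z_def by (intro definability)
  have mem_z: "v \<^bold>\<in> z W \<longleftrightarrow> (\<exists>s l. s \<^bold>\<in> ?C \<and> l \<^bold>\<in> W \<and> v = app f (opair E s l))" for v W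
    unfolding z_def mem_image_set[OF defun_app] mem_prod by blast
  have f_inj: "s = s' \<and> l = l'"
    if "s \<^bold>\<in> ?C" "l \<^bold>\<in> succ E b" "s' \<^bold>\<in> ?C" "l' \<^bold>\<in> succ E b" "app f (opair E s l) = app f (opair E s' l')" for s l s' l'
    using inj_onD[OF f(2) that(5)] that(1-4) by simp
  have z_outside: "v \<^bold>\<in> A \<and> \<not> v \<^bold>\<in> support P" if "W \<^bold>\<subseteq> succ E b" "v \<^bold>\<in> z W" for W v
    using that f(1) unfolding mem_z by (auto dest: subsetD)
  have z_sub: "z W \<^bold>\<subseteq> A" if "W \<^bold>\<subseteq> succ E b" for W using z_outside[OF that] by (simp add: subset_def)
  have z_supp: "\<And>v. v \<^bold>\<in> z W \<Longrightarrow> \<not> v \<^bold>\<in> support P" if "W \<^bold>\<subseteq> succ E b" for W using z_outside[OF that] by simp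
  have z_mono: "z W \<^bold>\<subseteq> z V" if "W \<^bold>\<subseteq> V" for W V
    using that by (auto simp: subset_def mem_z)
  have z_disj: "\<not> v \<^bold>\<in> z V" if "v \<^bold>\<in> z W" "W \<^bold>\<subseteq> succ E b" "V \<^bold>\<subseteq> succ E b" "\<not> (\<exists>l. l \<^bold>\<in> W \<and> l \<^bold>\<in> V)" for v W V
    using that f_inj unfolding mem_z by (metis subsetD)
  define y where "y W = enlarge P c (z W)" for W
  have dy [definability]: "defterm t \<Longrightarrow> defterm (\<lambda>e. y (t e))" for t
    unfolding y_def by (intro definability dz)
  have y_mono: "refines Q (y V)" if "refines Q (y W)" "W \<^bold>\<subseteq> V" "V \<^bold>\<subseteq> succ E b" for Q W V
    using refines_enlarge_mono[OF PB c z_sub[OF that(3)] z_supp[OF that(3)] z_mono[OF that(2)]] that(1)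
    unfolding y_def by blast
  have supp_y: "support (y W) = support P \<^bold>\<union> z W" if "W \<^bold>\<subseteq> succ E b" for W
    unfolding y_def by (rule support_enlarge[OF PB c z_sub[OF that] z_supp[OF that]])
  have y_B: "y W \<^bold>\<in> Bn E n A" if "W \<^bold>\<subseteq> succ E b" for W
    unfolding y_def
  proof (rule enlarge_Bn[OF PB c z_sub[OF that] z_supp[OF that]])
    show "finite_set E (z W)"
      unfolding z_def
      by (intro finite_image_set defun_app finite_prod finite_pow finite_tags b(1)
        finite_subset[OF finite_omega[OF succ_omega[OF b(1)]] that])
  qed
  have y_empty: "y (empty_set E) = P"
  proof -
    have "z (empty_set E) = empty_set E" by (rule eqI) (simp add: mem_z)
    then show ?thesis unfolding y_def by (simp add: enlarge_empty[OF PB c])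
  qed
  have sized: "sized b i (support (y W))" if W: "W \<^bold>\<subseteq> succ E b" "l \<^bold>\<in> W" for W l
    unfolding sized_def supp_y[OF W(1)]
  proof
    let ?h = "\<lambda>s. app f (opair E s l)"
    have "defun ?h" by (intro definability)
    moreover have "inj_on ?h (elts ?C)"
      using f_inj[of _ l _ l] W subsetD by (intro inj_onI) blast
    moreover have "?h s \<^bold>\<in> support P \<^bold>\<union> z W" if "s \<^bold>\<in> ?C" for s
      using that W(2) unfolding mem_un mem_z by blast
    ultimately show "?C \<^bold>\<preceq> support P \<^bold>\<union> z W" by (rule covered_by_inj)
    have "z W \<^bold>\<preceq> prod ?C (succ E b)"
      unfolding covered_by_def
      using W(1) unfolding z_def mem_image_set[OF defun_app] mem_prod subset_def by blast
    then show "\<not> pow (tags b (succ E i)) \<^bold>\<preceq> support P \<^bold>\<union> z W"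
      by (rule next_size_not_covered[OF b(1,3,2) supp_m])
  qed
  define T where "T = sep D (\<lambda>Q. refines Q (y (succ E b)))"
  have mem_T: "Q \<^bold>\<in> T \<longleftrightarrow> Q \<^bold>\<in> D \<and> refines Q (y (succ E b))" for Q
    unfolding T_def by (rule mem_ref)
  have fin_T: "finite_set E T"
    unfolding T_def using part finite_refinements Bn_finite_support n(1) y_B[OF subset_refl] by blast
  define small where "small Q \<longleftrightarrow> \<not> succ E b \<^bold>\<preceq> support Q" for Q
  define meets where "meets Q l \<longleftrightarrow> (\<exists>v. v \<^bold>\<in> support Q \<and> v \<^bold>\<in> z (upair E l l))" for Q l
  define R where "R W J Q \<longleftrightarrow> refines Q (y (W \<^bold>\<union> J)) \<and> small Q \<and> (\<forall>l. l \<^bold>\<in> J \<longrightarrow> meets Q l)" for W J Q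
  have dR: "defpred (\<lambda>e. R (t e) (u e) (v e))" if "defterm t" "defterm u" "defterm v" for t u v
    by (rule defpred_subst3[OF _ that, of R])
      (unfold R_def small_def meets_def, intro definability dy dz)
  have dR1: "defpred (\<lambda>e. R W J (e 0))" for W J by (intro dR definability)
  have mem_R: "Q \<^bold>\<in> sep T (R W J) \<longleftrightarrow> Q \<^bold>\<in> T \<and> R W J Q" for W J Q
    by (rule mem_sep[OF dR1])
  define e0 where "e0 \<longleftrightarrow> odd_set (sep T (R (empty_set E) (empty_set E)))"
  have un_empty: "W \<^bold>\<union> empty_set E = W" for W by (rule eqI) simp
  have "J \<^bold>\<subseteq> succ E b \<longrightarrow> (\<forall>W. W \<^bold>\<subseteq> succ E b \<and> \<not> (\<exists>l. l \<^bold>\<in> W \<and> l \<^bold>\<in> J) \<longrightarrow>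
      (odd_set (sep T (R W J)) \<longleftrightarrow> W = empty_set E \<and> e0))" if "finite_set E J" for J
    using that
  proof (induction rule: finite_induct)
    case definable show ?case by (intro definability dR)
  next
    case empty
    have "\<not> odd_set (sep T (R W (empty_set E)))" if W: "W \<^bold>\<subseteq> succ E b" "W \<noteq> empty_set E" for W
    proof -
      obtain l where l: "l \<^bold>\<in> W" using W(2) eq_empty_iff by blast
      have dS: "defpred (\<lambda>e. refines (e 0) (y W) \<and> \<not> succ E b \<^bold>\<preceq> support (e 0))"
        by (intro definability)
      have "sep T (R W (empty_set E)) = sep D (\<lambda>Q. refines Q (y W) \<and> \<not> succ E b \<^bold>\<preceq> support Q)"
        by (rule eqI) (use y_mono[OF _ W(1) subset_refl] in
          \<open>auto simp: mem_R mem_T mem_sep[OF dS] R_def small_def un_empty\<close>)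
      then show ?thesis using even[OF b(1,3) y_B[OF W(1)] sized[OF W(1) l]] by simp
    qed
    then show ?case unfolding e0_def by blast
  next
    case (ins J a)
    show ?case
    proof (intro impI allI)
      fix W assume sub: "ins a J \<^bold>\<subseteq> succ E b" and "W \<^bold>\<subseteq> succ E b \<and> \<not> (\<exists>l. l \<^bold>\<in> W \<and> l \<^bold>\<in> ins a J)"
      then have W: "W \<^bold>\<subseteq> succ E b" "\<not> a \<^bold>\<in> W" "\<And>l. l \<^bold>\<in> W \<Longrightarrow> \<not> l \<^bold>\<in> J" by auto
      have a: "a \<^bold>\<in> succ E b" and J: "J \<^bold>\<subseteq> succ E b" using sub by (simp_all add: subset_def)
      let ?V = "W \<^bold>\<union> ins a J"
      have V: "?V \<^bold>\<subseteq> succ E b" "W \<^bold>\<union> J \<^bold>\<subseteq> succ E b" "W \<^bold>\<union> J \<^bold>\<subseteq> ?V" "ins a W \<^bold>\<subseteq> succ E b"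
          "upair E a a \<^bold>\<subseteq> succ E b"
        using W(1) sub a J by (auto simp: subset_def)
      have V_eq: "ins a W \<^bold>\<union> J = ?V" by (rule eqI) auto
      have up: "refines Q (y (W \<^bold>\<union> J)) \<Longrightarrow> refines Q (y ?V)" for Q by (rule y_mono[OF _ V(3,1)])
      have avoid: "\<not> meets Q a" if "Q \<^bold>\<in> D" "refines Q (y (W \<^bold>\<union> J))" for Q
      proof
        assume "meets Q a"
        then obtain v where v: "v \<^bold>\<in> support Q" "v \<^bold>\<in> z (upair E a a)" unfolding meets_def by blast
        have "v \<^bold>\<in> support P \<^bold>\<union> z (W \<^bold>\<union> J)"
          using support_mono[OF part[OF that(1)] that(2)] v(1) unfolding supp_y[OF V(2)] by (rule subsetD)
        moreover have "\<not> v \<^bold>\<in> support P" using z_supp[OF V(5) v(2)] .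
        moreover have "\<not> v \<^bold>\<in> z (W \<^bold>\<union> J)"
          using z_disj[OF v(2) V(5,2)] W(2) ins(2) by auto
        ultimately show False by simp
      qed
      have shrink: "refines Q (y (W \<^bold>\<union> J))" if "Q \<^bold>\<in> D" "refines Q (y ?V)" "\<not> meets Q a" for Q
        unfolding y_def
      proof (rule refines_enlarge_shrink[OF PB c z_sub[OF V(2)] z_supp[OF V(2)] z_mono[OF V(3)] part[OF that(1)]])
        show "refines Q (enlarge P c (z ?V))" using that(2) unfolding y_def .
        show "\<not> v \<^bold>\<in> support Q" if v: "v \<^bold>\<in> z ?V" "\<not> v \<^bold>\<in> z (W \<^bold>\<union> J)" for v
        proof -
          have "v \<^bold>\<in> z (upair E a a)" using v unfolding mem_z mem_un mem_ins mem_upair by blast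
          then show ?thesis using \<open>\<not> meets Q a\<close> unfolding meets_def by blast
        qed
      qed
      have key: "R W (ins a J) Q \<longleftrightarrow> \<not> (R (ins a W) J Q \<longleftrightarrow> R W J Q)" if "Q \<^bold>\<in> D" for Q
        unfolding R_def V_eq mem_ins using up[of Q] avoid[OF that] shrink[OF that] by blast
      have dN: "defpred (\<lambda>e. \<not> (R (ins a W) J (e 0) \<longleftrightarrow> R W J (e 0)))" by (intro definability dR)
      have "sep T (R W (ins a J)) = sep T (\<lambda>Q. \<not> (R (ins a W) J Q \<longleftrightarrow> R W J Q))"
        by (rule eqI) (use key in \<open>unfold mem_R mem_sep[OF dN] mem_T, blast\<close>)
      then have "odd_set (sep T (R W (ins a J))) \<longleftrightarrow>
          \<not> (odd_set (sep T (R (ins a W) J)) \<longleftrightarrow> odd_set (sep T (R W J)))"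
        by (simp only: odd_set_sep_neq[OF fin_T dR1 dR1])
      moreover have "\<not> odd_set (sep T (R (ins a W) J))"
      proof -
        have "ins a W \<noteq> empty_set E" using mem_ins mem_empty by metis
        then show ?thesis using ins(2,3) J V(4) W(3) by auto
      qed
      moreover have "odd_set (sep T (R W J)) \<longleftrightarrow> W = empty_set E \<and> e0"
        using ins(3) J W by blast
      ultimately show "odd_set (sep T (R W (ins a J))) \<longleftrightarrow> W = empty_set E \<and> e0" by blast
    qed
  qed
  from this[OF finite_omega[OF succ_omega[OF b(1)]]]
  have "odd_set (sep T (R (empty_set E) (succ E b))) \<longleftrightarrow> e0"
    by (simp add: subset_def)
  moreover have "sep T (R (empty_set E) (succ E b)) = empty_set E"
  proof -
    have "\<not> R (empty_set E) (succ E b) Q" for Q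
    proof
      assume R: "R (empty_set E) (succ E b) Q"
      let ?g = "\<lambda>v. the_set (\<lambda>l. \<exists>s. s \<^bold>\<in> ?C \<and> l \<^bold>\<in> succ E b \<and> v = app f (opair E s l))"
      have "\<exists>v. v \<^bold>\<in> support Q \<and> l = ?g v" if l: "l \<^bold>\<in> succ E b" for l
      proof -
        obtain v where v: "v \<^bold>\<in> support Q" "v \<^bold>\<in> z (upair E l l)" using R l unfolding R_def meets_def by blast
        obtain s where s: "s \<^bold>\<in> ?C" "v = app f (opair E s l)" using v(2) unfolding mem_z by auto
        have "?g v = l"
          by (rule the_set_eq) (use s l f_inj in blast)+
        then show ?thesis using v(1) by blast
      qed
      moreover have "defun ?g" by (intro definability)
      ultimately have "succ E b \<^bold>\<preceq> support Q" by (intro covered_byI)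
      then show False using R unfolding R_def small_def by blast
    qed
    then show ?thesis by (intro eqI) (simp add: mem_R)
  qed
  moreover have "sep T (R (empty_set E) (empty_set E)) = ins P (empty_set E)"
  proof (rule eqI)
    fix Q
    have "refines P (y (succ E b))"
      by (rule y_mono[of P "empty_set E"]) (simp_all add: y_empty subset_def)
    then show "Q \<^bold>\<in> sep T (R (empty_set E) (empty_set E)) \<longleftrightarrow> Q \<^bold>\<in> ins P (empty_set E)"
      using P small_P minimal[of Q] by (auto simp: mem_R mem_T R_def un_empty y_empty small_def)
  qed
  ultimately show False unfolding e0_def by (simp add: odd_set_ins)
qed


section \<open>The theorem of Cantor and Bernstein\<close>

text \<open>
  The set \<open>W\<close> on which the bijection agrees with \<open>F\<close> is the greatest \<open>W \<subseteq> X\<close> with \<open>W \<subseteq> X - G(Y - F(W))\<close>.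
  It is the union of all such sets (\<open>closed\<close>), which makes it definable. By maximality, every point of
  \<open>X - W\<close> is in \<open>G(Y - F(W))\<close>, and there the bijection is the inverse of \<open>G\<close>.
\<close>

lemma Cantor_Bernstein:
  assumes F: "defun F" "inj_on F (elts X)" "\<And>x. x \<^bold>\<in> X \<Longrightarrow> F x \<^bold>\<in> Y"
    and G: "defun G" "inj_on G (elts Y)" "\<And>y. y \<^bold>\<in> Y \<Longrightarrow> G y \<^bold>\<in> X"
  shows "equipotent E X Y"
proof -
  define closed where "closed S \<longleftrightarrow>
    (\<forall>u y. u \<^bold>\<in> S \<and> y \<^bold>\<in> Y \<and> u = G y \<longrightarrow> (\<exists>v. v \<^bold>\<in> S \<and> y = F v))" for S
  have dc: "defterm t \<Longrightarrow> defpred (\<lambda>e. closed (t e))" for t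
    by (rule defpred_subst1[where P = closed])
      (unfold closed_def, intro definability defterm_subst1[OF F(1)] defterm_subst1[OF G(1)])
  define W where "W = sep X (\<lambda>x. \<exists>S. S \<^bold>\<subseteq> X \<and> x \<^bold>\<in> S \<and> closed S)"
  have W: "x \<^bold>\<in> W \<longleftrightarrow> (\<exists>S. S \<^bold>\<subseteq> X \<and> x \<^bold>\<in> S \<and> closed S)" for x
  proof -
    have "x \<^bold>\<in> W \<longleftrightarrow> x \<^bold>\<in> X \<and> (\<exists>S. S \<^bold>\<subseteq> X \<and> x \<^bold>\<in> S \<and> closed S)"
      unfolding W_def by (rule mem_sep) (intro definability dc)
    then show ?thesis by (auto dest: subsetD)
  qed
  have WX: "W \<^bold>\<subseteq> X" by (rule subsetI) (auto simp: W dest: subsetD)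
  have closed_W: "\<exists>v. v \<^bold>\<in> W \<and> y = F v" if "y \<^bold>\<in> Y" "G y \<^bold>\<in> W" for y
    using that unfolding W closed_def by blast
  have outside: "\<exists>y. y \<^bold>\<in> Y \<and> x = G y \<and> \<not> (\<exists>v. v \<^bold>\<in> W \<and> y = F v)" if x: "x \<^bold>\<in> X" "\<not> x \<^bold>\<in> W" for x
  proof (rule ccontr)
    assume not: "\<not> ?thesis"
    have "closed (ins x W)"
      unfolding closed_def
    proof (intro allI impI)
      fix u y assume u: "u \<^bold>\<in> ins x W \<and> y \<^bold>\<in> Y \<and> u = G y"
      then have "\<exists>v. v \<^bold>\<in> W \<and> y = F v" using not closed_W[of y] by auto
      then show "\<exists>v. v \<^bold>\<in> ins x W \<and> y = F v" by auto
    qed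
    moreover have "ins x W \<^bold>\<subseteq> X" using x(1) WX by (auto simp: subset_def)
    ultimately have "x \<^bold>\<in> W" unfolding W by (intro exI[of _ "ins x W"]) simp
    then show False using x(2) by simp
  qed
  define k where "k x = (if x \<^bold>\<in> W then F x else the_set (\<lambda>y. y \<^bold>\<in> Y \<and> x = G y))" for x
  have dk: "defun k"
    unfolding k_def by (intro definability defterm_subst1[OF F(1)] defterm_subst1[OF G(1)])
  have G_eq: "y = y'" if "y \<^bold>\<in> Y" "y' \<^bold>\<in> Y" "G y = G y'" for y y'
    using inj_onD[OF G(2) that(3)] that(1,2) by simp
  have F_eq: "x = x'" if "x \<^bold>\<in> X" "x' \<^bold>\<in> X" "F x = F x'" for x x'
    using inj_onD[OF F(2) that(3)] that(1,2) by simp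
  have k_W: "k x = F x" if "x \<^bold>\<in> W" for x using that by (simp add: k_def)
  have k_G: "k (G y) = y" if "y \<^bold>\<in> Y" "\<not> G y \<^bold>\<in> W" for y
  proof -
    have "the_set (\<lambda>y'. y' \<^bold>\<in> Y \<and> G y = G y') = y"
      by (rule the_set_eq) (use that(1) G_eq in blast)+
    then show ?thesis using that(2) unfolding k_def by simp
  qed
  have "bij_betw k (elts X) (elts Y)"
  proof (rule bij_betw_imageI)
    show "inj_on k (elts X)"
    proof (rule inj_onI)
      fix x x' assume "x \<in> elts X" "x' \<in> elts X" and eq: "k x = k x'"
      then have x: "x \<^bold>\<in> X" "x' \<^bold>\<in> X" by simp_all
      have ne: "k u \<noteq> k w" if u: "u \<^bold>\<in> W" and w: "w \<^bold>\<in> X" "\<not> w \<^bold>\<in> W" for u w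
        using outside[OF w] k_W[OF u] k_G u w by metis
      show "x = x'"
      proof (cases "x \<^bold>\<in> W"; cases "x' \<^bold>\<in> W")
        assume "x \<^bold>\<in> W" "x' \<^bold>\<in> W"
        then show ?thesis using eq k_W F_eq x by metis
      next
        assume "\<not> x \<^bold>\<in> W" "\<not> x' \<^bold>\<in> W"
        then show ?thesis using eq k_G outside x by metis
      qed (use ne x eq in metis)+
    qed
    have "k x \<^bold>\<in> Y" if "x \<^bold>\<in> X" for x
      using that F(3) k_W outside[of x] k_G by metis
    moreover have "\<exists>x. x \<^bold>\<in> X \<and> y = k x" if y: "y \<^bold>\<in> Y" for y
    proof (cases "G y \<^bold>\<in> W")
      case True
      then show ?thesis using closed_W[OF y] k_W WX subsetD by metis
    next
      case False
      then show ?thesis using k_G[OF y] G(3)[OF y] by metis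
    qed
    ultimately show "k ` elts X = elts Y" by auto
  qed
  then show ?thesis by (rule equipotentI[OF dk])
qed


section \<open>Coding sequences of sets of partitions\<close>

lemma mem_two: "x \<^bold>\<in> two E \<longleftrightarrow> x = empty_set E \<or> x = succ E (empty_set E)"
  unfolding two_def by auto

lemma zero_neq_one: "empty_set E \<noteq> succ E (empty_set E)"
  using mem_succ mem_empty by metis

definition code :: "'a \<Rightarrow> 'a \<Rightarrow> 'a \<Rightarrow> bool" where
  "code B h y \<longleftrightarrow> (\<exists>b i. b \<^bold>\<in> omega E \<and> i \<^bold>\<in> b \<and> sized b i (support y) \<and>
     odd_set (sep B (\<lambda>Q. (refines Q y \<and> \<not> succ E b \<^bold>\<preceq> support Q) \<and> app (app h i) Q = succ E (empty_set E))))"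

text \<open>
  At a partition \<open>y\<close> of class \<open>(b, i)\<close>, the code depends on \<open>h(i)\<close> only, by \<open>sized_unique\<close>. By additivity of
  parity, two sequences with the same code satisfy the premise of \<open>parities_determine\<close> for the
  symmetric difference of their \<open>i\<close>-th terms, which is therefore empty.
\<close>

lemma code_inject:
  assumes A: "\<not> finite_set E A" and n: "n \<^bold>\<in> omega E" "n \<noteq> empty_set E"
    and h: "is_function E h (omega E) (card_exp E (two E) (Bn E n A))"
    and h': "is_function E h' (omega E) (card_exp E (two E) (Bn E n A))"
    and code: "\<And>y. y \<^bold>\<in> Bn E n A \<Longrightarrow> code (Bn E n A) h y \<longleftrightarrow> code (Bn E n A) h' y"
  shows "h = h'"
proof (rule function_eqI[OF h h'])
  let ?B = "Bn E n A" and ?one = "succ E (empty_set E)"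
  fix i assume i: "i \<^bold>\<in> omega E"
  have fn: "is_function E (app h i) ?B (two E)" "is_function E (app h' i) ?B (two E)"
    using app_mem[OF h i] app_mem[OF h' i] by (simp_all add: mem_card_exp)
  let ?P = "\<lambda>Q. app (app h i) Q = ?one" and ?P' = "\<lambda>Q. app (app h' i) Q = ?one"
  have dP: "defpred (\<lambda>e. ?P (e 0))" "defpred (\<lambda>e. ?P' (e 0))" by (intro definability)+
  have dN: "defpred (\<lambda>e. \<not> (?P (e 0) \<longleftrightarrow> ?P' (e 0)))" by (intro definability)
  define D where "D = sep ?B (\<lambda>Q. \<not> (?P Q \<longleftrightarrow> ?P' Q))"
  have mem_D: "Q \<^bold>\<in> D \<longleftrightarrow> Q \<^bold>\<in> ?B \<and> \<not> (?P Q \<longleftrightarrow> ?P' Q)" for Q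
    unfolding D_def by (rule mem_sep[OF dN])
  have "\<not> Q \<^bold>\<in> D" for Q
  proof (rule parities_determine[OF A n i])
    show "D \<^bold>\<subseteq> ?B" by (rule subsetI) (simp only: mem_D)
    fix b y assume b: "b \<^bold>\<in> omega E" "i \<^bold>\<in> b" and y: "y \<^bold>\<in> ?B" "sized b i (support y)"
    let ?S = "\<lambda>Q. refines Q y \<and> \<not> succ E b \<^bold>\<preceq> support Q"
    have dS: "defpred (\<lambda>e. ?S (e 0))" by (intro definability)
    define T where "T = sep ?B ?S"
    have mem_T: "Q \<^bold>\<in> T \<longleftrightarrow> Q \<^bold>\<in> ?B \<and> ?S Q" for Q
      unfolding T_def by (rule mem_sep[OF dS])
    have "T \<^bold>\<subseteq> sep ?B (\<lambda>Q. refines Q y)"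
      by (rule subsetI, subst mem_sep) (intro definability, simp add: mem_T)
    then have fin_T: "finite_set E T"
      by (rule finite_subset[rotated])
        (rule finite_refinements[OF Bn_finite_support[OF n(1) y(1)]], rule Bn_partition)
    have sep_T: "sep T R = sep ?B (\<lambda>Q. ?S Q \<and> R Q)" if R: "defpred (\<lambda>e. R (e 0))" for R
    proof (rule eqI)
      have dSR: "defpred (\<lambda>e. ?S (e 0) \<and> R (e 0))" by (intro definability R)
      show "Q \<^bold>\<in> sep T R \<longleftrightarrow> Q \<^bold>\<in> sep ?B (\<lambda>Q. ?S Q \<and> R Q)" for Q
        unfolding mem_sep[OF R] mem_sep[OF dSR] mem_T by blast
    qed
    have code_iff: "code ?B g y \<longleftrightarrow> odd_set (sep T (\<lambda>Q. app (app g i) Q = ?one))" for g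
    proof -
      have "c = b \<and> j = i" if "c \<^bold>\<in> omega E" "j \<^bold>\<in> c" "sized c j (support y)" for c j
        using sized_unique[OF that b y(2)] .
      then have "code ?B g y \<longleftrightarrow> odd_set (sep ?B (\<lambda>Q. ?S Q \<and> app (app g i) Q = ?one))"
        unfolding code_def using b y(2) by blast
      moreover have "sep T (\<lambda>Q. app (app g i) Q = ?one) = sep ?B (\<lambda>Q. ?S Q \<and> app (app g i) Q = ?one)"
        by (rule sep_T) (intro definability)
      ultimately show ?thesis by simp
    qed
    have "sep D ?S = sep T (\<lambda>Q. \<not> (?P Q \<longleftrightarrow> ?P' Q))"
      by (rule eqI) (unfold mem_sep[OF dS] mem_sep[OF dN] mem_D mem_T, blast)
    then show "\<not> odd_set (sep D ?S)"
      using code[OF y(1)] unfolding code_iff by (simp only: odd_set_sep_neq[OF fin_T dP])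
  qed
  then have "?P Q \<longleftrightarrow> ?P' Q" if "Q \<^bold>\<in> ?B" for Q using that mem_D by blast
  then show "app h i = app h' i"
    using app_mem[OF fn(1)] app_mem[OF fn(2)] by (intro function_eqI[OF fn]) (metis mem_two)
qed

lemma power_Bn_omega:
  assumes A: "\<not> finite_set E A" and n: "n \<^bold>\<in> omega E" "n \<noteq> empty_set E"
  shows "equipotent E (card_exp E (card_exp E (two E) (Bn E n A)) (omega E)) (card_exp E (two E) (Bn E n A))"
proof -
  let ?B = "Bn E n A" and ?one = "succ E (empty_set E)"
  let ?Y = "card_exp E (two E) ?B"
  let ?X = "card_exp E ?Y (omega E)"
  let ?f = "\<lambda>h y. if code ?B h y then ?one else empty_set E"
  have dcode: "defpred (\<lambda>e. code ?B (t e) (u e))" if "defterm t" "defterm u" for t u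
    by (rule defpred_subst2[OF _ that, of "code ?B"]) (unfold code_def, intro definability)
  have df: "defun (?f h)" for h by (intro definability dcode)
  show ?thesis
  proof (rule Cantor_Bernstein)
    show "defun (\<lambda>h. graph (?f h) ?B)" by (intro definability dcode)
    show "graph (?f h) ?B \<^bold>\<in> ?Y" for h
      unfolding mem_card_exp by (rule is_function_graph[OF df]) (simp add: mem_two)
    show "inj_on (\<lambda>h. graph (?f h) ?B) (elts ?X)"
    proof (rule inj_onI)
      fix h h' assume h: "h \<in> elts ?X" "h' \<in> elts ?X" and eq: "graph (?f h) ?B = graph (?f h') ?B"
      show "h = h'"
      proof (rule code_inject[OF A n])
        fix y assume "y \<^bold>\<in> ?B"
        then have "?f h y = ?f h' y" using app_graph[OF df] eq by metis
        then show "code ?B h y \<longleftrightarrow> code ?B h' y" using zero_neq_one by (metis (full_types))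
      qed (use h in \<open>simp_all add: mem_card_exp\<close>)
    qed
    have dconst: "defun (\<lambda>i. a)" for a by (intro definability)
    show "defun (\<lambda>a. graph (\<lambda>i. a) (omega E))" by (intro definability)
    show "graph (\<lambda>i. a) (omega E) \<^bold>\<in> ?X" if "a \<^bold>\<in> ?Y" for a
      unfolding mem_card_exp[of _ ?Y] by (rule is_function_graph[OF dconst]) (rule that)
    show "inj_on (\<lambda>a. graph (\<lambda>i. a) (omega E)) (elts ?Y)"
      by (rule inj_onI) (metis app_graph[OF dconst zero_omega])
  qed
qed

end

theorem corollary3p6:
  fixes E :: "'a \<Rightarrow> 'a \<Rightarrow> bool"
  assumes "ZF_model E"
  shows "\<forall>A n. \<not> finite_set E A \<and> E n (omega E) \<and> n \<noteq> empty_set E \<longrightarrow>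
    equipotent E
      (card_exp E (card_exp E (two E) (Bn E n A)) (omega E))
      (card_exp E (two E) (Bn E n A))"
proof -
  interpret ZF_model E by (rule assms)
  show ?thesis using power_Bn_omega by blast
qed

end
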